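(* Let $K$ be a field of characteristic zero, let $S$ be a finite inverse semigroup and let $e\in E(S)$. Let $\theta$ be a character of $S$ (over $K$) and let $\chi$ be an irreducible character (over $K$) of the maximal subgroup $G_e$. Denote by $d$ the dimension over $K$ of the division algebra associated to $\chi$ and by $m$ the multiplicity of the induced irreducible character $\chi^*$ of $S$ in $\theta$. Then \[(\chi,\theta)_S=\sum_{f\in E(S),\, f\le e}(\chi,\theta_f)_{G_e}\,\mu(f,e)=md .\]
   Context: An inverse semigroup is a semigroup $S$ in which every $s$ has a unique $s^{-1}$ with $ss^{-1}s=s$ and $s^{-1}ss^{-1}=s^{-1}$. $E(S)$ is its set of idempotents (they commute). Put $\mathrm{dom}(s)=ss^{-1}$, $\mathrm{ran}(s)=s^{-1}s$. The natural partial order is $s\le t\iff s=et$ for some $e\in E(S)$; $\mu$ is the (integer-valued) M\"obius function of the finite poset $(S,\le)$; on intervals between idempotents it agrees with the M\"obius function of $E(S)$. For $e\in E(S)$ the maximal subgroup at $e$ is the group $G_e=\{s\in S: ss^{-1}=e=s^{-1}s\}$. Idempotents $e,f$ are isomorphic if there is $s\in S$ with $\mathrm{dom}(s)=e$, $\mathrm{ran}(s)=f$. A character is the trace function of a finite-dimensional representation over $K$ (by matrices, $S\to M_n(K)$). The division algebra associated to an irreducible character $\chi$ of $G_e$ is the algebra of $KG_e$-endomorphisms of the simple $KG_e$-module affording $\chi$. For $K$-valued functions $\psi,\alpha$ on a finite group $G$, $(\psi,\alpha)_G=\frac1{|G|}\sum_{g\in G}\psi(g^{-1})\alpha(g)$.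 For $f\in E(S)$, $\theta_f(s)=\theta(fs)$, restricted to $G_e$ where needed. By definition $(\chi,\theta)_S=\sum_{f\in E(S), f\le e}(\chi,\theta_f)_{G_e}\mu(f,e)$. Induced irreducible character $\chi^*$: let $\varphi$ be an irreducible representation of $G_e$ with character $\chi$. Let $X$ be the set of idempotents isomorphic to $e$, and for each $f\in X$ fix $p_f\in S$ with $\mathrm{dom}(p_f)=e$, $\mathrm{ran}(p_f)=f$. Then $\varphi^*$ is the irreducible representation of $S$ by $X\times X$ block matrices whose $(f,f')$ block at $s$ is $\varphi(p_f\, s\, p_{f'}^{-1})$ if $f\le ss^{-1}$ and $s^{-1}fs=f'$, and $0$ otherwise; $\chi^*$ is its character (independent of the choices). The multiplicity of $\chi^*$ in $\theta$ is the multiplicity of $\varphi^*$ as an irreducible constituent of a representation affording $\theta$. *)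

theory Defs
  imports "Jordan_Normal_Form.VS_Connect"
begin

section \<open>Inverse semigroups\<close>

text \<open>
  The operation \<open>\<le>\<close> is the natural partial order; that it is a partial order is
  proved below, not assumed.
\<close>

class inverse_semigroup = semigroup_mult + ord +
  assumes ex1_semigroup_inverse: "\<exists>!t. s * t * s = s \<and> t * s * t = t"
    and natural_order: "s \<le> t \<longleftrightarrow> (\<exists>e. e * e = e \<and> s = e * t)"
    and natural_order_strict: "s < t \<longleftrightarrow> s \<le> t \<and> s \<noteq> t"
begin

lemma semigroup_inverse_unique:
  "s * t * s = s \<Longrightarrow> t * s * t = t \<Longrightarrow> s * u * s = s \<Longrightarrow> u * s * u = u \<Longrightarrow> t = u"
  using ex1_semigroup_inverse by blast

lemma idempotent_mult:
  assumes e: "e * e = e" and f: "f * f = f"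
  shows "e * f * (e * f) = e * f"
proof -
  have ee: "\<And>z. e * (e * z) = e * z" and ff: "\<And>z. f * (f * z) = f * z"
    using e f by (metis mult.assoc)+
  obtain x where x1: "e * f * x * (e * f) = e * f" and x2: "x * (e * f) * x = x"
    using ex1_semigroup_inverse[of "e * f"] by blast
  have x2': "\<And>z. x * (e * (f * (x * z))) = x * z" using x2 by (metis mult.assoc)
  have "x = f * x * e"
  proof (rule semigroup_inverse_unique[OF x1 x2])
    show "e * f * (f * x * e) * (e * f) = e * f"
      using x1 by (simp add: mult.assoc ee ff)
    show "f * x * e * (e * f) * (f * x * e) = f * x * e"
      by (simp add: mult.assoc ee ff x2')
  qed
  then have "x * x = x"
    by (metis (no_types, lifting) mult.assoc x2)
  then have "x = e * f"
    using semigroup_inverse_unique[of x x "e * f"] x1 x2 by simp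
  with \<open>x * x = x\<close> show ?thesis by simp
qed

lemma idempotent_commute:
  assumes e: "e * e = e" and f: "f * f = f"
  shows "e * f = f * e"
proof -
  have ee: "\<And>z. e * (e * z) = e * z" and ff: "\<And>z. f * (f * z) = f * z"
    using e f by (metis mult.assoc)+
  have ef: "e * f * (e * f) = e * f" and fe: "f * e * (f * e) = f * e"
    using idempotent_mult e f by auto
  show ?thesis
    by (rule semigroup_inverse_unique[of "e * f"])
      (use ef fe in \<open>simp_all add: mult.assoc ee ff\<close>)
qed

subclass order
proof
  show refl: "x \<le> x" for x
    using ex1_semigroup_inverse[of x] natural_order by (metis mult.assoc)
  show "x \<le> z" if "x \<le> y" "y \<le> z" for x y z
    using that idempotent_mult unfolding natural_order by (metis mult.assoc)
  show antisym: "x = y" if "x \<le> y" "y \<le> x" for x y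
    using that idempotent_commute unfolding natural_order by (metis mult.assoc)
  show "x < y \<longleftrightarrow> x \<le> y \<and> \<not> y \<le> x" for x y
    using antisym refl natural_order_strict by blast
qed

end

definition sinv :: "'s::inverse_semigroup \<Rightarrow> 's" where
  "sinv s = (THE t. s * t * s = s \<and> t * s * t = t)"

definition idempotents :: "'s::inverse_semigroup set" where
  "idempotents = {e. e * e = e}"

definition sdom :: "'s::inverse_semigroup \<Rightarrow> 's" where
  "sdom s = s * sinv s"

definition sran :: "'s::inverse_semigroup \<Rightarrow> 's" where
  "sran s = sinv s * s"

definition max_subgroup :: "'s::inverse_semigroup \<Rightarrow> 's monoid" where
  "max_subgroup e = \<lparr>carrier = {s. sdom s = e \<and> sran s = e}, mult = (*), one = e\<rparr>"

definition isomorphic_idempotents :: "'s::inverse_semigroup \<Rightarrow> 's set" where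
  "isomorphic_idempotents e = {f \<in> idempotents. \<exists>s. sdom s = e \<and> sran s = f}"

function mobius :: "'a::{finite,order} \<Rightarrow> 'a \<Rightarrow> int" where
  "mobius x y = (if x = y then 1
     else if x < y then - (\<Sum>z\<in>{z. x \<le> z \<and> z < y}. mobius x z)
     else 0)"
  by auto
termination
  by (relation "measure (\<lambda>(x, y). card {w. w < y})")
    (auto intro!: psubset_card_mono)

declare mobius.simps [simp del]


section \<open>Matrix representations\<close>

text \<open>
  Representations are taken of a subset \<open>A\<close> of a semigroup that is closed under
  multiplication, so that \<open>S\<close> itself (\<open>A = UNIV\<close>) and its maximal subgroups are
  treated uniformly.  Matrices act on column vectors.
\<close>

definition mat_trace :: "'k::comm_monoid_add mat \<Rightarrow> 'k" where
  "mat_trace M = (\<Sum>i<dim_row M. M $$ (i, i))"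

definition matrix_rep ::
    "'s::semigroup_mult set \<Rightarrow> nat \<Rightarrow> ('s \<Rightarrow> 'k::field mat) \<Rightarrow> bool" where
  "matrix_rep A n \<rho> \<longleftrightarrow>
     (\<forall>s\<in>A. \<rho> s \<in> carrier_mat n n) \<and> (\<forall>s\<in>A. \<forall>t\<in>A. \<rho> (s * t) = \<rho> s * \<rho> t)"

definition affords ::
    "'s::semigroup_mult set \<Rightarrow> nat \<Rightarrow> ('s \<Rightarrow> 'k::field mat) \<Rightarrow> ('s \<Rightarrow> 'k) \<Rightarrow> bool" where
  "affords A n \<rho> \<theta> \<longleftrightarrow> matrix_rep A n \<rho> \<and> (\<forall>s\<in>A. \<theta> s = mat_trace (\<rho> s))"

definition invariant_subspace ::
    "'s set \<Rightarrow> nat \<Rightarrow> ('s \<Rightarrow> 'k::field mat) \<Rightarrow> 'k vec set \<Rightarrow> bool" where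
  "invariant_subspace A n \<rho> W \<longleftrightarrow>
     VectorSpace.subspace class_ring W (module_vec TYPE('k) n) \<and>
     (\<forall>s\<in>A. \<forall>w\<in>W. \<rho> s *\<^sub>v w \<in> W)"

text \<open>
  Irreducible representations are not identically zero.  This forces \<open>n > 0\<close>, excludes
  the zero representation of degree 1 and, when \<open>A\<close> is a group, forces the group
  identity to act as the identity matrix (its image is an invariant subspace).
\<close>

definition irreducible_rep ::
    "'s::semigroup_mult set \<Rightarrow> nat \<Rightarrow> ('s \<Rightarrow> 'k::field mat) \<Rightarrow> bool" where
  "irreducible_rep A n \<rho> \<longleftrightarrow> matrix_rep A n \<rho> \<and> (\<exists>s\<in>A. \<rho> s \<noteq> 0\<^sub>m n n) \<and>
     (\<forall>W. invariant_subspace A n \<rho> W \<longrightarrow> W = {0\<^sub>v n} \<or> W = carrier_vec n)"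

text \<open>The algebra of endomorphisms of the module \<open>K\<^sup>n\<close> given by \<open>\<rho>\<close>, and its dimension over \<open>K\<close>.\<close>

definition endomorphism_algebra ::
    "'s set \<Rightarrow> nat \<Rightarrow> ('s \<Rightarrow> 'k::field mat) \<Rightarrow> 'k mat set" where
  "endomorphism_algebra A n \<rho> = {T \<in> carrier_mat n n. \<forall>s\<in>A. T * \<rho> s = \<rho> s * T}"

definition endomorphism_dim :: "'s set \<Rightarrow> nat \<Rightarrow> ('s \<Rightarrow> 'k::field mat) \<Rightarrow> nat" where
  "endomorphism_dim A n \<rho> = vectorspace.dim class_ring
     ((module_mat TYPE('k) n n)\<lparr>carrier := endomorphism_algebra A n \<rho>\<rparr>)"


section \<open>Multiplicity as an irreducible constituent\<close>

text \<open>A factor of a composition series may also be the one-dimensional zero module.\<close>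

definition composition_series ::
    "'s set \<Rightarrow> nat \<Rightarrow> ('s \<Rightarrow> 'k::field mat) \<Rightarrow> 'k vec set list \<Rightarrow> bool" where
  "composition_series A n \<rho> Ws \<longleftrightarrow>
     Ws \<noteq> [] \<and> hd Ws = {0\<^sub>v n} \<and> last Ws = carrier_vec n \<and>
     (\<forall>W\<in>set Ws. invariant_subspace A n \<rho> W) \<and>
     (\<forall>i. Suc i < length Ws \<longrightarrow> Ws ! i \<subset> Ws ! Suc i \<and>
        (\<forall>U. invariant_subspace A n \<rho> U \<and> Ws ! i \<subseteq> U \<and> U \<subseteq> Ws ! Suc i \<longrightarrow>
           U = Ws ! i \<or> U = Ws ! Suc i))"

text \<open>
  The quotient \<open>W / U\<close> affords a representation equivalent to \<open>\<sigma>\<close>: there is an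
  equivariant linear surjection from \<open>W\<close> onto \<open>K\<^sup>k\<close> with kernel \<open>U\<close>.  The matrix \<open>T\<close> is
  an arbitrary linear extension of this surjection to \<open>K\<^sup>n\<close>.
\<close>

definition factor_equivalent ::
    "'s set \<Rightarrow> nat \<Rightarrow> ('s \<Rightarrow> 'k::field mat) \<Rightarrow> 'k vec set \<Rightarrow> 'k vec set \<Rightarrow>
     nat \<Rightarrow> ('s \<Rightarrow> 'k mat) \<Rightarrow> bool" where
  "factor_equivalent A n \<rho> U W k \<sigma> \<longleftrightarrow>
     (\<exists>T \<in> carrier_mat k n. (\<lambda>w. T *\<^sub>v w) ` W = carrier_vec k \<and>
        {w \<in> W. T *\<^sub>v w = 0\<^sub>v k} = U \<and>
        (\<forall>s\<in>A. \<forall>w\<in>W. T *\<^sub>v (\<rho> s *\<^sub>v w) = \<sigma> s *\<^sub>v (T *\<^sub>v w)))"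

definition multiplicity_in ::
    "'s set \<Rightarrow> nat \<Rightarrow> ('s \<Rightarrow> 'k::field mat) \<Rightarrow> nat \<Rightarrow> ('s \<Rightarrow> 'k mat) \<Rightarrow> nat" where
  "multiplicity_in A k \<sigma> n \<rho> =
     (THE m. \<exists>Ws. composition_series A n \<rho> Ws \<and>
        m = card {i. Suc i < length Ws \<and>
              factor_equivalent A n \<rho> (Ws ! i) (Ws ! Suc i) k \<sigma>})"


section \<open>Induced representation and pairings\<close>

text \<open>
  The list \<open>fs\<close> enumerates the set \<open>X\<close> of idempotents isomorphic to \<open>e\<close>.  Row and column
  \<open>a * n + b\<close> with \<open>b < n\<close> stand for position \<open>b\<close> inside the block of \<open>fs ! a\<close>.
\<close>

definition induced_rep ::
    "nat \<Rightarrow> ('s::inverse_semigroup \<Rightarrow> 'k::field mat) \<Rightarrow> 's list \<Rightarrow> ('s \<Rightarrow> 's) \<Rightarrow> 's \<Rightarrow> 'k mat" where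
  "induced_rep n \<phi> fs p s = mat (length fs * n) (length fs * n) (\<lambda>(i, j).
     let f = fs ! (i div n); f' = fs ! (j div n) in
       if f \<le> s * sinv s \<and> sinv s * f * s = f'
       then \<phi> (p f * s * sinv (p f')) $$ (i mod n, j mod n) else 0)"

definition group_pairing ::
    "('g, 'r) monoid_scheme \<Rightarrow> ('g \<Rightarrow> 'k::field) \<Rightarrow> ('g \<Rightarrow> 'k) \<Rightarrow> 'k" where
  "group_pairing G \<psi> \<alpha> =
     1 / of_nat (card (carrier G)) * (\<Sum>g\<in>carrier G. \<psi> (inv\<^bsub>G\<^esub> g) * \<alpha> g)"

definition semigroup_pairing ::
    "'s::{finite,inverse_semigroup} \<Rightarrow> ('s \<Rightarrow> 'k::field) \<Rightarrow> ('s \<Rightarrow> 'k) \<Rightarrow> 'k" where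
  "semigroup_pairing e \<chi> \<theta> =
     (\<Sum>f\<in>{f \<in> idempotents. f \<le> e}.
        group_pairing (max_subgroup e) \<chi> (\<lambda>s. \<theta> (f * s)) * of_int (mobius f e))"

end

theory Submission
  imports Defs "HOL-Library.Function_Algebras"
begin

text \<open>
  Write \<open>G\<close> for the maximal subgroup at \<open>e\<close> and \<open>\<Phi> \<theta>\<close> for the pairing \<open>(\<chi>, \<theta>)\<^sub>S\<close>, and
  let \<open>\<epsilon> = \<Sum>\<^sub>f \<mu>(f, e) f\<close> be the alternating sum over the idempotents \<open>f \<le> e\<close> in the
  semigroup algebra. For a representation \<open>\<sigma>\<close> of \<open>S\<close> with character \<open>\<theta>\<close>, cyclicity of
  the trace turns the definition into
  \<open>\<Phi> \<theta> = |G|\<^sup>-\<^sup>1 \<Sum>\<^sub>g \<chi>(g\<^sup>-\<^sup>1) tr (\<sigma>(g) \<sigma>(\<epsilon>))\<close>, which is the trace of the operator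
  \<open>Y \<mapsto> |G|\<^sup>-\<^sup>1 \<Sum>\<^sub>g \<sigma>(g) \<sigma>(\<epsilon>) Y \<phi>(g)\<^sup>-\<^sup>1\<close> on matrices. By Weisner's theorem
  \<open>f \<epsilon> = 0\<close> for every idempotent \<open>f < e\<close>, so the values of this operator are
  \<open>G\<close>-homomorphisms from \<open>\<phi>\<close> to \<open>\<sigma>\<close> that are annihilated by all \<open>f < e\<close>.

  The functional \<open>\<Phi>\<close> is additive, and the character of a representation is the sum of the
  characters of the factors of any composition series. Hence it suffices to evaluate
  \<open>\<Phi>\<close> on the factors, each of which is simple.
  \<^item> If a factor is equivalent to the induced representation \<open>\<phi>\<^sup>*\<close>, its
    character is \<open>\<chi>\<^sup>*\<close>. On elements \<open>f g\<close> with \<open>f \<le> e\<close> and \<open>g \<in> G\<close> this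
    vanishes unless \<open>f = e\<close>, where it is \<open>\<chi> g\<close>. So the value is
    \<open>(\<chi>, \<chi>)\<^sub>G\<close>, the trace of the averaging projection onto the endomorphism algebra
    of \<open>\<phi>\<close>, that is \<open>d\<close>.
  \<^item> If \<open>\<Phi>\<close> does not vanish on a factor, the operator above has a nonzero value \<open>X\<close>.
    The map sending a vector with blocks \<open>c\<^sub>f\<close> to
    \<open>\<Sum>\<^sub>f \<sigma>(p\<^sub>f\<^sup>-\<^sup>1) X c\<^sub>f\<close> is then a homomorphism from \<open>\<phi>\<^sup>*\<close> to the factor; it is
    injective because \<open>X\<close> is, and surjective because the factor is simple. So
    the factor is equivalent to \<open>\<phi>\<^sup>*\<close>.

  Therefore every composition series gives \<open>\<Phi> \<theta> = m d\<close> with \<open>m\<close> the number of its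
  factors equivalent to \<open>\<phi>\<^sup>*\<close>. In characteristic zero, and since \<open>d > 0\<close>, this equation
  also shows that \<open>m\<close> is the same for all composition series, so that the multiplicity is
  well defined. The evaluation on factors is \<open>pairing_simple_factor\<close>, and the sum over a
  composition series is \<open>pairing_composition_series\<close>.
\<close>

section \<open>Functions as vectors\<close>

text \<open>
  Vectors and matrices of a fixed size form a carrier set, not a type. Read as functions that
  vanish outside a finite index set they live in a type that is a vector space,
  where bases and left inverses of linear maps are available.
\<close>

definition fscale :: "'k::field \<Rightarrow> ('i \<Rightarrow> 'k) \<Rightarrow> 'i \<Rightarrow> 'k" where
  "fscale c f = (\<lambda>i. c * f i)"

interpretation fun_vs: vector_space fscale
  by unfold_locales (auto simp: fscale_def fun_eq_iff algebra_simps)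

interpretation fun_vs_pair: vector_space_pair fscale fscale ..

definition kronecker :: "'i \<Rightarrow> 'i \<Rightarrow> 'k::field" where
  "kronecker i = (\<lambda>j. if j = i then 1 else 0)"

lemma sum_fun_apply: "(\<Sum>x\<in>S. g x) i = (\<Sum>x\<in>S. g x i)"
  by (induction S rule: infinite_finite_induct) auto

lemma function_as_kronecker_sum:
  assumes "finite I" "\<And>i. i \<notin> I \<Longrightarrow> f i = 0"
  shows "f = (\<Sum>i\<in>I. fscale (f i) (kronecker i))"
proof
  fix j
  have "(\<Sum>i\<in>I. fscale (f i) (kronecker i)) j = (\<Sum>i\<in>I. if i = j then f i else 0)"
    by (subst sum_fun_apply, rule sum.cong) (auto simp: fscale_def kronecker_def)
  also have "\<dots> = f j"
    using assms by (auto simp: sum.delta')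
  finally show "f j = (\<Sum>i\<in>I. fscale (f i) (kronecker i)) j" by simp
qed

lemma in_span_kronecker:
  assumes "finite I" "\<And>i. i \<notin> I \<Longrightarrow> f i = 0"
  shows "f \<in> fun_vs.span (kronecker ` I)"
proof -
  have "(\<Sum>i\<in>I. fscale (f i) (kronecker i)) \<in> fun_vs.span (kronecker ` I)"
    by (auto intro!: fun_vs.span_sum fun_vs.span_scale intro: fun_vs.span_base)
  then show ?thesis
    using function_as_kronecker_sum[where f = f, OF assms] by (metis (no_types))
qed

lemma linear_kronecker_expansion:
  fixes P :: "('i \<Rightarrow> 'k::field) \<Rightarrow> 'j \<Rightarrow> 'k"
  assumes "Vector_Spaces.linear fscale fscale P" "finite I" "\<And>i. i \<notin> I \<Longrightarrow> f i = 0"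
  shows "P f = (\<Sum>i\<in>I. fscale (f i) (P (kronecker i)))"
proof -
  interpret P: Vector_Spaces.linear fscale fscale P by fact
  have "P f = P (\<Sum>i\<in>I. fscale (f i) (kronecker i))"
    using arg_cong[where f = P, OF function_as_kronecker_sum[where f = f, OF assms(2,3)]] .
  also have "\<dots> = (\<Sum>i\<in>I. fscale (f i) (P (kronecker i)))"
    by (simp add: P.sum P.scale)
  finally show ?thesis .
qed

text \<open>
  Expanding each \<open>P (kronecker i)\<close> in the basis \<open>B\<close> of the image turns the
  trace into the sum over \<open>b \<in> B\<close> of the coordinate of \<open>P b = b\<close> along \<open>b\<close>, which is \<open>1\<close>.
\<close>

lemma trace_of_projection:
  fixes P :: "('i \<Rightarrow> 'k::field) \<Rightarrow> 'i \<Rightarrow> 'k" and E :: "('i \<Rightarrow> 'k) set"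
  assumes lin: "Vector_Spaces.linear fscale fscale P" and I: "finite I"
    and supp: "\<And>f i. f \<in> E \<Longrightarrow> i \<notin> I \<Longrightarrow> f i = 0"
    and E: "fun_vs.subspace E"
    and into: "\<And>i. i \<in> I \<Longrightarrow> P (kronecker i) \<in> E" and id: "\<And>f. f \<in> E \<Longrightarrow> P f = f"
    and B: "fun_vs.independent B" "fun_vs.span B = E"
  shows "(\<Sum>i\<in>I. P (kronecker i) i) = of_nat (card B)" and "finite B"
proof -
  have BE: "B \<subseteq> E" using B(2) fun_vs.span_superset by blast
  have "B \<subseteq> fun_vs.span (kronecker ` I)"
    using BE supp in_span_kronecker[OF I] by blast
  then show fin: "finite B"
    using fun_vs.independent_span_bound[OF _ B(1)] I by blast
  let ?r = "fun_vs.representation B"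
  have rep: "f i = (\<Sum>b\<in>B. ?r f b * b i)" if "f \<in> E" for f i
  proof -
    have "f = (\<Sum>b\<in>B. fscale (?r f b) b)"
      using fun_vs.sum_representation_eq[OF B(1) _ fin order_refl, of f] that B(2) by simp
    then have "f i = (\<Sum>b\<in>B. fscale (?r f b) b) i" by simp
    then show ?thesis by (simp add: sum_fun_apply fscale_def)
  qed
  have "(\<Sum>i\<in>I. P (kronecker i) i) = (\<Sum>i\<in>I. \<Sum>b\<in>B. ?r (P (kronecker i)) b * b i)"
    by (rule sum.cong[OF refl], rule rep, rule into)
  also have "\<dots> = (\<Sum>b\<in>B. \<Sum>i\<in>I. ?r (P (kronecker i)) b * b i)"
    by (rule sum.swap)
  also have "\<dots> = (\<Sum>b\<in>B. ?r (P b) b)"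
  proof (rule sum.cong[OF refl])
    fix b assume b: "b \<in> B"
    have "?r (P b) = ?r (\<Sum>i\<in>I. fscale (b i) (P (kronecker i)))"
      using arg_cong[where f = ?r, OF linear_kronecker_expansion[where f = b, OF lin I]] supp b BE
      by blast
    also have "\<dots> = (\<lambda>c. \<Sum>i\<in>I. ?r (fscale (b i) (P (kronecker i))) c)"
      by (rule fun_vs.representation_sum[OF B(1)]) (use into B(2) in \<open>auto intro: fun_vs.span_scale\<close>)
    finally have "?r (P b) b = (\<Sum>i\<in>I. b i * ?r (P (kronecker i)) b)"
      by (simp add: fun_vs.representation_scale[OF B(1)] into B(2))
    then show "(\<Sum>i\<in>I. ?r (P (kronecker i)) b * b i) = ?r (P b) b"
      by (simp add: mult.commute)
  qed
  also have "\<dots> = (\<Sum>b\<in>B. 1)"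
    by (rule sum.cong[OF refl]) (use BE in \<open>auto simp: id subset_iff fun_vs.representation_basis[OF B(1)]\<close>)
  finally show "(\<Sum>i\<in>I. P (kronecker i) i) = of_nat (card B)" by simp
qed

section \<open>Subspaces of coordinate space\<close>

definition flat :: "'k::zero vec \<Rightarrow> nat \<Rightarrow> 'k" where
  "flat v = (\<lambda>i. if i < dim_vec v then v $ i else 0)"

lemma vec_flat: "v \<in> carrier_vec n \<Longrightarrow> vec n (flat v) = v"
  by (auto simp: flat_def)

text \<open>
  The locale predicate for subspaces, with its module structure unfolded.
\<close>

definition vec_subspace :: "nat \<Rightarrow> 'k::field vec set \<Rightarrow> bool" where
  "vec_subspace n W \<longleftrightarrow> W \<subseteq> carrier_vec n \<and> 0\<^sub>v n \<in> W \<and> (\<forall>v\<in>W. \<forall>w\<in>W. v + w \<in> W) \<and>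
     (\<forall>c. \<forall>v\<in>W. c \<cdot>\<^sub>v v \<in> W)"

lemma subspace_iff_vec_subspace:
  "VectorSpace.subspace class_ring W (module_vec TYPE('k::field) n) \<longleftrightarrow> vec_subspace n W"
proof -
  interpret v: vec_space "TYPE('k)" n .
  have "Module.module (class_ring :: 'k ring) (module_vec TYPE('k) n)"
    by (rule v.module_axioms)
  then show ?thesis
    using v.vectorspace_axioms
    unfolding VectorSpace.subspace_def submodule_def vec_subspace_def
    by (auto simp: module_vec_simps)
qed

lemma invariant_subspace_iff:
  "invariant_subspace A n \<rho> W \<longleftrightarrow> vec_subspace n W \<and> (\<forall>s\<in>A. \<forall>w\<in>W. \<rho> s *\<^sub>v w \<in> W)"
  unfolding invariant_subspace_def subspace_iff_vec_subspace ..

lemma vec_subspaceD: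
  assumes "vec_subspace n W"
  shows "W \<subseteq> carrier_vec n" "0\<^sub>v n \<in> W" "\<And>v w. v \<in> W \<Longrightarrow> w \<in> W \<Longrightarrow> v + w \<in> W"
    "\<And>c v. v \<in> W \<Longrightarrow> c \<cdot>\<^sub>v v \<in> W" "\<And>v w. v \<in> W \<Longrightarrow> w \<in> W \<Longrightarrow> v - w \<in> W"
proof -
  show "v - w \<in> W" if "v \<in> W" "w \<in> W" for v w
  proof -
    have "v - w = v + (- 1) \<cdot>\<^sub>v w"
      using that assms unfolding vec_subspace_def by (intro eq_vecI) auto
    then show ?thesis using that assms unfolding vec_subspace_def by metis
  qed
qed (use assms in \<open>auto simp: vec_subspace_def\<close>)

lemma subspace_flat:
  assumes "vec_subspace n W"
  shows "fun_vs.subspace (flat ` W)"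
proof (rule fun_vs.subspaceI)
  note W = vec_subspaceD[OF assms]
  show "0 \<in> flat ` W"
    by (rule image_eqI[OF _ W(2)]) (auto simp: flat_def)
  show "x + y \<in> flat ` W" if xy: "x \<in> flat ` W" "y \<in> flat ` W" for x y
  proof -
    obtain v w where "v \<in> W" "w \<in> W" "x = flat v" "y = flat w" using xy by auto
    moreover then have "v \<in> carrier_vec n" "w \<in> carrier_vec n" using W(1) by auto
    then have "flat v + flat w = flat (v + w)" by (auto simp: flat_def fun_eq_iff)
    ultimately show ?thesis using W(3) by (metis imageI)
  qed
  show "fscale c x \<in> flat ` W" if x: "x \<in> flat ` W" for c x
  proof -
    obtain v where "v \<in> W" "x = flat v" using x by auto
    moreover then have "fscale c x = flat (c \<cdot>\<^sub>v v)" by (auto simp: flat_def fscale_def)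
    ultimately show ?thesis using W(4) by blast
  qed
qed

text \<open>
  A linear map that is injective on a subspace has a left inverse there; tabulating its values on
  the unit vectors makes it a matrix. This one fact supplies projections onto subspaces, retractions
  of injective matrices, and the inverse of an isomorphism between a simple factor and another
  module.
\<close>

lemma left_inverse_on_subspace:
  fixes T :: "'k::field mat"
  assumes W: "vec_subspace n W" and T: "T \<in> carrier_mat k n"
    and inj: "\<And>w. w \<in> W \<Longrightarrow> T *\<^sub>v w = 0\<^sub>v k \<Longrightarrow> w = 0\<^sub>v n"
  obtains L where "L \<in> carrier_mat n k" "\<And>y. y \<in> carrier_vec k \<Longrightarrow> L *\<^sub>v y \<in> W"
    "\<And>w. w \<in> W \<Longrightarrow> L *\<^sub>v (T *\<^sub>v w) = w"
proof -
  note Wn = vec_subspaceD[OF W]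
  define f where "f = (\<lambda>x. flat (T *\<^sub>v vec n x))"
  have lin: "Vector_Spaces.linear fscale fscale f"
  proof (unfold_locales, goal_cases)
    case (1 x y)
    have "vec n (x + y) = vec n x + vec n y" by auto
    then show ?case
      using T by (auto simp: f_def flat_def fun_eq_iff mult_add_distrib_mat_vec[OF T])
  next
    case (2 c x)
    have "vec n (fscale c x) = c \<cdot>\<^sub>v vec n x" by (auto simp: fscale_def)
    then show ?case
      using T by (auto simp: f_def flat_def fscale_def fun_eq_iff mult_mat_vec[OF T])
  qed
  have "inj_on f (flat ` W)"
  proof (rule inj_onI)
    fix x y assume xy: "x \<in> flat ` W" "y \<in> flat ` W" "f x = f y"
    then obtain v w where vw: "v \<in> W" "w \<in> W" "x = flat v" "y = flat w" by auto
    with Wn(1) have vwc: "v \<in> carrier_vec n" "w \<in> carrier_vec n" by auto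
    have "T *\<^sub>v v = T *\<^sub>v w"
      using arg_cong[OF xy(3), of "vec k"] vw vwc T by (simp add: f_def vec_flat)
    then have "T *\<^sub>v (v - w) = 0\<^sub>v k"
      using T vwc by (simp add: mult_minus_distrib_mat_vec[OF T])
    then have "v - w = 0\<^sub>v n" using inj Wn(5) vw by blast
    then have "v $ i - w $ i = 0" if "i < n" for i
      using that vwc by (metis carrier_vecD index_minus_vec(1) index_zero_vec(1))
    then have "v = w" using vwc by (intro eq_vecI) auto
    then show "x = y" using vw by simp
  qed
  from fun_vs_pair.linear_exists_left_inverse_on[OF lin subspace_flat[OF W] this]
  obtain g where g: "range g \<subseteq> flat ` W" "Vector_Spaces.linear fscale fscale g" "\<And>v. v \<in> flat ` W \<Longrightarrow> g (f v) = v"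
    by auto
  define L where "L = mat n k (\<lambda>(i, j). g (kronecker j) i)"
  have L: "L \<in> carrier_mat n k" by (simp add: L_def)
  have Ly: "L *\<^sub>v y = vec n (g (flat y))" if y: "y \<in> carrier_vec k" for y
  proof (rule eq_vecI)
    fix i assume "i < dim_vec (vec n (g (flat y)))"
    then have i: "i < n" by simp
    have "g (flat y) i = (\<Sum>j\<in>{0..<k}. fscale (flat y j) (g (kronecker j))) i"
      by (subst linear_kronecker_expansion[OF g(2), where I = "{0..<k}"]) (use y in \<open>auto simp: flat_def\<close>)
    also have "\<dots> = (\<Sum>j\<in>{0..<k}. g (kronecker j) i * y $ j)"
      unfolding sum_fun_apply by (rule sum.cong) (use y in \<open>auto simp: fscale_def flat_def\<close>)
    finally show "(L *\<^sub>v y) $ i = vec n (g (flat y)) $ i"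
      using i y by (simp add: L_def scalar_prod_def)
  qed (simp add: L_def)
  have gW: "vec n (g x) \<in> W" for x
  proof -
    obtain w where "w \<in> W" "g x = flat w" using g(1) by blast
    then show ?thesis using Wn(1) vec_flat by (metis subsetD)
  qed
  have "L *\<^sub>v (T *\<^sub>v w) = w" if w: "w \<in> W" for w
  proof -
    have wc: "w \<in> carrier_vec n" using w Wn(1) by auto
    have "L *\<^sub>v (T *\<^sub>v w) = vec n (g (f (flat w)))"
      using Ly[of "T *\<^sub>v w"] T wc by (simp add: f_def vec_flat)
    then show ?thesis using g(3) w wc by (simp add: vec_flat)
  qed
  with that L Ly gW show thesis by metis
qed

lemma projection_onto_subspace:
  fixes W :: "'k::field vec set"
  assumes W: "vec_subspace n W"
  obtains P where "P \<in> carrier_mat n n" "\<And>v. v \<in> carrier_vec n \<Longrightarrow> P *\<^sub>v v \<in> W"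
    "\<And>w. w \<in> W \<Longrightarrow> P *\<^sub>v w = w"
proof -
  have c: "w \<in> carrier_vec n" if "w \<in> W" for w using that vec_subspaceD(1)[OF W] by auto
  show thesis
    by (rule left_inverse_on_subspace[OF W one_carrier_mat]) (use c that in auto)
qed

text \<open>
  The measure for the construction of composition series.
\<close>

definition subspace_dim :: "'k::field vec set \<Rightarrow> nat" where
  "subspace_dim W = fun_vs.dim (flat ` W)"

lemma subspace_dim_strict_mono:
  assumes U: "vec_subspace n U" and W: "vec_subspace n W" and UW: "U \<subset> W"
  shows "subspace_dim U < subspace_dim W"
proof -
  have inj: "inj_on flat W"
    by (rule inj_onI) (metis subsetD vec_flat vec_subspaceD(1)[OF W])
  obtain B where B: "B \<subseteq> flat ` U" "fun_vs.independent B" "flat ` U \<subseteq> fun_vs.span B"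
    using fun_vs.maximal_independent_subset by blast
  have sB: "fun_vs.span B \<subseteq> flat ` U"
    by (rule fun_vs.span_minimal[OF B(1) subspace_flat[OF U]])
  have "B \<subseteq> flat ` W" using B(1) UW by auto
  from fun_vs.maximal_independent_subset_extend[OF this B(2)]
  obtain C where C: "B \<subseteq> C" "C \<subseteq> flat ` W" "fun_vs.independent C" "flat ` W \<subseteq> fun_vs.span C" .
  have "B \<noteq> C"
  proof
    assume "B = C"
    then have "flat ` W \<subseteq> flat ` U" using C(4) sB by auto
    then have "W \<subseteq> U" using UW inj_onD[OF inj] by (blast dest: subsetD)
    with UW show False by auto
  qed
  have "flat ` W \<subseteq> fun_vs.span (kronecker ` {..<n})"
    using vec_subspaceD(1)[OF W] by (auto intro!: in_span_kronecker simp: flat_def split: if_splits)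
  then have "finite C"
    using fun_vs.independent_span_bound[OF _ C(3), of "kronecker ` {..<n}"] C(2) by auto
  then have "card B < card C" using C(1) \<open>B \<noteq> C\<close> by (meson psubsetI psubset_card_mono)
  then show ?thesis
    unfolding subspace_dim_def
    using fun_vs.basis_card_eq_dim[OF B(1,3,2)] fun_vs.basis_card_eq_dim[OF C(2,4,3)] by simp
qed

section \<open>Inverse semigroups\<close>

lemma sinv_regular [simp]: "s * sinv s * s = s" "sinv s * s * sinv s = sinv s"
  using theI'[OF ex1_semigroup_inverse[of s]] unfolding sinv_def by auto

lemma sinv_regular_assoc [simp]:
  "s * (sinv s * s) = s" "sinv s * (s * sinv s) = sinv s"
  "s * (sinv s * (s * t)) = s * t" "sinv s * (s * (sinv s * t)) = sinv s * t"
  using sinv_regular[of s] by (metis mult.assoc)+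

lemma sinv_eqI: "s * t * s = s \<Longrightarrow> t * s * t = t \<Longrightarrow> sinv s = t"
  by (rule semigroup_inverse_unique[of s]) auto

lemma sinv_sinv [simp]: "sinv (sinv s) = s"
  by (rule sinv_eqI) auto

lemma idempotentsD: "e \<in> idempotents \<Longrightarrow> e * e = e" "e \<in> idempotents \<Longrightarrow> e * (e * x) = e * x"
  unfolding idempotents_def by (auto simp flip: mult.assoc)

lemma idempotents_commute: "e \<in> idempotents \<Longrightarrow> f \<in> idempotents \<Longrightarrow> e * f = f * e"
  by (rule idempotent_commute) (auto dest: idempotentsD)

lemma idempotents_mult: "e \<in> idempotents \<Longrightarrow> f \<in> idempotents \<Longrightarrow> e * f \<in> idempotents"
  unfolding idempotents_def using idempotent_mult by auto

lemma sdom_idempotent [simp]: "s * sinv s \<in> idempotents" and sran_idempotent [simp]: "sinv s * s \<in> idempotents"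
  by (auto simp: idempotents_def mult.assoc)

lemma sinv_idempotent: "e \<in> idempotents \<Longrightarrow> sinv e = e"
  by (rule sinv_eqI) (auto simp: idempotentsD)

lemma conjugate_mult:
  assumes "e \<in> idempotents" "f \<in> idempotents"
  shows "sinv s * e * s * (sinv s * f * s) = sinv s * (e * f) * s"
proof -
  have "sinv s * e * s * (sinv s * f * s) = sinv s * (e * (s * sinv s)) * f * s"
    by (simp add: mult.assoc)
  also have "\<dots> = sinv s * ((s * sinv s) * e) * f * s"
    using idempotents_commute[OF assms(1) sdom_idempotent[of s]] by simp
  also have "\<dots> = sinv s * (e * f) * s"
    by (simp add: mult.assoc)
  finally show ?thesis .
qed

lemma conjugate_idempotent: "e \<in> idempotents \<Longrightarrow> sinv s * e * s \<in> idempotents"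
  using conjugate_mult[of e e s] by (simp add: idempotents_def)

lemma idempotent_slide:
  assumes "e \<in> idempotents" shows "e * s = s * (sinv s * e * s)"
proof -
  have "s * (sinv s * e * s) = ((s * sinv s) * e) * s" by (simp add: mult.assoc)
  also have "\<dots> = e * (s * sinv s) * s"
    using idempotents_commute[OF assms sdom_idempotent[of s]] by simp
  finally show ?thesis by (simp add: mult.assoc)
qed

lemma sinv_mult: "sinv (s * t) = sinv t * sinv s"
proof (rule sinv_eqI)
  have c: "(t * sinv t) * (sinv s * s) = (sinv s * s) * (t * sinv t)"
    by (intro idempotents_commute) auto
  have "s * t * (sinv t * sinv s) * (s * t) = s * ((t * sinv t) * (sinv s * s)) * t"
    by (simp add: mult.assoc)
  also have "\<dots> = s * t" unfolding c by (simp add: mult.assoc)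
  finally show "s * t * (sinv t * sinv s) * (s * t) = s * t" .
  have "sinv t * sinv s * (s * t) * (sinv t * sinv s) = sinv t * ((sinv s * s) * (t * sinv t)) * sinv s"
    by (simp add: mult.assoc)
  also have "\<dots> = sinv t * sinv s" unfolding c[symmetric] by (simp add: mult.assoc)
  finally show "sinv t * sinv s * (s * t) * (sinv t * sinv s) = sinv t * sinv s" .
qed

lemma le_idempotent:
  assumes "e \<in> idempotents" "s \<le> e"
  shows "s \<in> idempotents" "s * e = s" "e * s = s"
proof -
  obtain h where h: "h * h = h" "s = h * e" using assms(2) natural_order by auto
  then have hi: "h \<in> idempotents" by (simp add: idempotents_def)
  show s: "s \<in> idempotents" using h idempotents_mult[OF hi assms(1)] by simp
  show se: "s * e = s" using h assms(1) by (simp add: mult.assoc idempotentsD)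
  show "e * s = s" using idempotents_commute[OF s assms(1)] se by simp
qed

lemma idempotent_le_iff:
  assumes "e \<in> idempotents" "f \<in> idempotents"
  shows "f \<le> e \<longleftrightarrow> f * e = f"
  using assms le_idempotent(2) natural_order idempotentsD(1) by metis

lemma idempotent_mult_le:
  assumes "e \<in> idempotents" "f \<in> idempotents"
  shows "f * e \<le> e" "f * e \<le> f"
proof -
  have i: "f * e \<in> idempotents" using assms by (simp add: idempotents_mult)
  show "f * e \<le> e" using assms by (simp add: idempotent_le_iff i mult.assoc idempotentsD)
  have "f * e * f = f * f * e"
    using idempotents_commute[OF assms] by (simp add: mult.assoc)
  then show "f * e \<le> f" using assms by (simp add: idempotent_le_iff i idempotentsD)
qed

lemma idempotent_le_mult_iff:
  assumes "e \<in> idempotents" "f \<in> idempotents"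
  shows "k \<le> f * e \<longleftrightarrow> k \<le> f \<and> k \<le> e"
proof
  assume "k \<le> f * e" then show "k \<le> f \<and> k \<le> e"
    using idempotent_mult_le[OF assms] order_trans by blast
next
  assume k: "k \<le> f \<and> k \<le> e"
  then have "k \<in> idempotents" "k * f = k" "k * e = k" using assms le_idempotent by auto
  then show "k \<le> f * e"
    by (simp add: idempotent_le_iff idempotents_mult assms flip: mult.assoc)
qed

lemma conjugate_le:
  assumes "f \<in> idempotents"
  shows "sinv s * f * s \<le> sinv s * s"
  by (subst idempotent_le_iff[OF sran_idempotent conjugate_idempotent[OF assms]])
    (simp add: mult.assoc)

section \<open>Maximal subgroups\<close>

lemma max_subgroup_iff: "g \<in> carrier (max_subgroup e) \<longleftrightarrow> g * sinv g = e \<and> sinv g * g = e"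
  by (auto simp: max_subgroup_def sdom_def sran_def)

lemma max_subgroupD:
  assumes "g \<in> carrier (max_subgroup e)"
  shows "g * sinv g = e" "sinv g * g = e" "e * g = g" "g * e = g" "e * sinv g = sinv g" "sinv g * e = sinv g"
    "sinv g \<in> carrier (max_subgroup e)" "e \<in> idempotents"
proof -
  show e: "g * sinv g = e" "sinv g * g = e" using assms by (auto simp: max_subgroup_iff)
  show "e * g = g" "e * sinv g = sinv g" unfolding e(1)[symmetric] e(2)[symmetric]
    by (simp, unfold e(1) e(2)[symmetric], simp)
  show "g * e = g" "sinv g * e = sinv g"
    by (subst e(2)[symmetric], simp flip: mult.assoc) (subst e(1)[symmetric], simp flip: mult.assoc)
  show "sinv g \<in> carrier (max_subgroup e)" using e by (auto simp: max_subgroup_iff)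
  show "e \<in> idempotents" using sdom_idempotent[of g] e by simp
qed

lemma max_subgroup_mult:
  assumes "g \<in> carrier (max_subgroup e)" "h \<in> carrier (max_subgroup e)"
  shows "g * h \<in> carrier (max_subgroup e)"
proof -
  note g = max_subgroupD[OF assms(1)] and h = max_subgroupD[OF assms(2)]
  have "g * h * sinv (g * h) = g * (h * sinv h) * sinv g" by (simp add: sinv_mult mult.assoc)
  moreover have "sinv (g * h) * (g * h) = sinv h * (sinv g * g) * h" by (simp add: sinv_mult mult.assoc)
  ultimately show ?thesis using g h by (simp add: max_subgroup_iff)
qed

lemma max_subgroup_one: "e \<in> idempotents \<Longrightarrow> e \<in> carrier (max_subgroup e)"
  by (simp add: max_subgroup_iff sinv_idempotent idempotentsD)

lemma max_subgroup_simps [simp]: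
  "mult (max_subgroup e) = (*)" "one (max_subgroup e) = e"
  by (auto simp: max_subgroup_def)

lemma max_subgroup_group:
  assumes "e \<in> idempotents" shows "group (max_subgroup e)"
proof (rule groupI)
  show "\<exists>y\<in>carrier (max_subgroup e). y \<otimes>\<^bsub>max_subgroup e\<^esub> x = \<one>\<^bsub>max_subgroup e\<^esub>"
    if "x \<in> carrier (max_subgroup e)" for x
    by (rule bexI[of _ "sinv x"]) (use max_subgroupD[OF that] in auto)
qed (use assms in \<open>auto simp: max_subgroup_mult max_subgroup_one mult.assoc max_subgroupD\<close>)

lemma max_subgroup_inv:
  assumes "g \<in> carrier (max_subgroup e)"
  shows "inv\<^bsub>max_subgroup e\<^esub> g = sinv g"
  by (rule group.inv_equality) (use max_subgroupD[OF assms] max_subgroup_group assms in auto)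

lemma group_pairing_max_subgroup:
  "group_pairing (max_subgroup e) \<psi> \<alpha> =
     1 / of_nat (card (carrier (max_subgroup e))) * (\<Sum>g\<in>carrier (max_subgroup e). \<psi> (sinv g) * \<alpha> g)"
  unfolding group_pairing_def by (simp add: max_subgroup_inv cong: sum.cong)

text \<open>
  Conjugation by the inverse element undoes conjugation by \<open>g\<close> and fixes \<open>e\<close>, so an idempotent
  other than \<open>e\<close> cannot be sent to \<open>e\<close>.
\<close>

lemma conjugate_less:
  assumes g: "g \<in> carrier (max_subgroup e)" and f: "f < e"
  shows "sinv g * f * g < e"
proof -
  note G = max_subgroupD[OF g]
  have fi: "f \<in> idempotents" "f * e = f" "e * f = f"
    using le_idempotent[of e f] f G by auto
  have "sinv g * f * g \<noteq> e"
  proof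
    assume "sinv g * f * g = e"
    then have "g * (sinv g * f * g) * sinv g = g * e * sinv g" by simp
    moreover have "g * (sinv g * f * g) * sinv g = (g * sinv g) * f * (g * sinv g)"
      by (simp add: mult.assoc)
    ultimately have "f = e" using G fi by simp
    with f show False by simp
  qed
  then show ?thesis using conjugate_le[OF fi(1), of g] G by simp
qed

text \<open>
  Conjugation by \<open>s\<close> embeds the idempotents below \<open>e\<close> into those below \<open>f\<close>. If \<open>f \<le> e\<close> then,
  by finiteness, the two down-sets have the same elements.
\<close>

lemma isomorphic_idempotent_le_eq:
  fixes e :: "'s::{finite, inverse_semigroup}"
  assumes "sdom s = e" "sran s = f" "f \<le> e"
  shows "f = e"
proof -
  have s: "s * sinv s = e" "sinv s * s = f" using assms by (auto simp: sdom_def sran_def)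
  then have i: "e \<in> idempotents" "f \<in> idempotents" by auto
  have inj: "inj_on (\<lambda>h. sinv s * h * s) {h. h \<le> e}"
  proof (rule inj_onI)
    fix h h' assume h: "h \<in> {h. h \<le> e}" "h' \<in> {h. h \<le> e}" and eq: "sinv s * h * s = sinv s * h' * s"
    have "s * (sinv s * x * s) * sinv s = x" if "x \<le> e" for x
    proof -
      have "s * (sinv s * x * s) * sinv s = (s * sinv s) * x * (s * sinv s)" by (simp add: mult.assoc)
      then show ?thesis using s le_idempotent[OF i(1) that] by simp
    qed
    then show "h = h'" using h eq by (metis mem_Collect_eq)
  qed
  have "(\<lambda>h. sinv s * h * s) ` {h. h \<le> e} \<subseteq> {h. h \<le> f}"
    using conjugate_le[of _ s] le_idempotent(1)[OF i(1)] s by auto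
  then have "card {h. h \<le> e} \<le> card {h. h \<le> f}"
    using card_inj_on_le[OF inj] by simp
  moreover have "{h. h \<le> f} \<subseteq> {h. h \<le> e}" using assms(3) order_trans by auto
  ultimately have "{h. h \<le> f} = {h. h \<le> e}"
    by (metis card_seteq finite)
  then have "e \<le> f" by auto
  then show ?thesis using assms(3) by (rule antisym[rotated])
qed

section \<open>The Moebius function\<close>

lemma mobius_not_le: "\<not> x \<le> y \<Longrightarrow> mobius x y = 0"
  by (subst mobius.simps) auto

lemma mobius_nonzero_le: "mobius x y \<noteq> 0 \<Longrightarrow> x \<le> y"
  using mobius_not_le by blast

lemma mobius_sum_upper:
  "(\<Sum>w | w \<le> y. mobius x w) = (if x = y then 1 else 0)"
proof -
  have "(\<Sum>w | w \<le> y. mobius x w) = (\<Sum>w | x \<le> w \<and> w \<le> y. mobius x w)"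
    by (rule sum.mono_neutral_right) (auto dest: mobius_nonzero_le)
  also have "\<dots> = (if x = y then 1 else 0)"
  proof (cases "x < y")
    case True
    then have "{w. x \<le> w \<and> w \<le> y} = insert y {w. x \<le> w \<and> w < y}" by auto
    then show ?thesis using True by (simp add: mobius.simps[of x y])
  next
    case False
    then have "{w. x \<le> w \<and> w \<le> y} = (if x = y then {y} else {})" by auto
    then show ?thesis by (simp add: mobius.simps[of y y])
  qed
  finally show ?thesis .
qed

text \<open>
  The recursion defining \<open>mobius\<close> makes it a left inverse of the zeta function, which is
  \<open>mobius_sum_upper\<close>; this lemma makes it a right inverse. With \<open>D x w\<close> the sum in question,
  summing \<open>D x w\<close> over \<open>w \<le> y\<close> gives the zeta function again, and
  this determines \<open>D\<close> by induction on \<open>y\<close>.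
\<close>

lemma mobius_sum_lower:
  fixes x y :: "'a::{finite,order}"
  shows "(\<Sum>z | x \<le> z. mobius z y) = (if x = y then 1 else 0)"
proof (induction "card {w. w < y}" arbitrary: y rule: less_induct)
  case less
  let ?D = "\<lambda>w. \<Sum>z | x \<le> z. mobius z w"
  have "(\<Sum>w | w \<le> y. ?D w) = (\<Sum>z | x \<le> z. \<Sum>w | w \<le> y. mobius z w)"
    by (rule sum.swap)
  also have "\<dots> = (if x \<le> y then 1 else 0)"
    by (simp add: mobius_sum_upper)
  finally have tot: "(\<Sum>w | w \<le> y. ?D w) = (if x \<le> y then 1 else 0)" .
  have "{w. w \<le> y} = insert y {w. w < y}" by auto
  then have "(\<Sum>w | w \<le> y. ?D w) = ?D y + (\<Sum>w | w < y. ?D w)" by simp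
  moreover have "(\<Sum>w | w < y. ?D w) = (\<Sum>w | w < y. if x = w then 1 else 0)"
  proof (rule sum.cong[OF refl])
    fix w assume "w \<in> {w. w < y}"
    then have "card {v. v < w} < card {v. v < y}"
      by (intro psubset_card_mono) auto
    then show "?D w = (if x = w then 1 else 0)" by (rule less)
  qed
  moreover have "\<dots> = (if x < y then 1 else 0)" by simp
  ultimately show ?case using tot by (auto split: if_splits)
qed

text \<open>
  Weisner's theorem in the semilattice of idempotents below \<open>e\<close>. The sums for all
  \<open>k' \<ge> k\<close> add up to the sum of \<open>mobius h e\<close> over all \<open>h \<ge> k\<close>, which
  vanishes as \<open>k \<le> f < e\<close>; so each of them vanishes by downward induction on \<open>k\<close>.
\<close>

lemma weisner_mobius_sum:
  fixes e f :: "'s::{finite, inverse_semigroup}"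
  assumes e: "e \<in> idempotents" and f: "f < e"
  shows "(\<Sum>h | h \<le> e \<and> f * h = k. mobius h e) = 0"
proof (induction "card {w. k < w}" arbitrary: k rule: less_induct)
  case less
  have fi: "f \<in> idempotents" using le_idempotent(1)[OF e] f by simp
  have hi: "h \<in> idempotents" if "h \<le> e" for h using that by (rule le_idempotent(1)[OF e])
  let ?F = "\<lambda>k. \<Sum>h | h \<le> e \<and> f * h = k. mobius h e"
  show ?case
  proof (cases "k \<le> f")
    case False
    have "{h. h \<le> e \<and> f * h = k} = {}"
      using False idempotent_mult_le(2)[OF hi fi] by auto
    then show ?thesis by (simp only: sum.empty)
  next
    case True
    have "(\<Sum>k' | k \<le> k'. ?F k') = (\<Sum>k' | k \<le> k'. \<Sum>h | h \<in> {h. k \<le> h \<and> h \<le> e} \<and> f * h = k'. mobius h e)"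
      by (intro sum.cong refl) (use idempotent_le_mult_iff[OF hi fi] in auto)
    also have "\<dots> = (\<Sum>h\<in>{h. k \<le> h \<and> h \<le> e}. mobius h e)"
      by (rule sum.group) (use True idempotent_le_mult_iff[OF hi fi] in auto)
    also have "\<dots> = (\<Sum>h | k \<le> h. mobius h e)"
      by (rule sum.mono_neutral_left) (auto dest: mobius_nonzero_le)
    also have "\<dots> = 0" using True f by (simp add: mobius_sum_lower)
    finally have "(\<Sum>k' | k \<le> k'. ?F k') = 0" .
    moreover have "{k'. k \<le> k'} = insert k {k'. k < k'}" by auto
    moreover have "(\<Sum>k' | k < k'. ?F k') = 0"
    proof (rule sum.neutral, rule ballI)
      fix k' assume "k' \<in> {k'. k < k'}"
      then have "card {w. k' < w} < card {w. k < w}"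
        by (intro psubset_card_mono) auto
      then show "?F k' = 0" by (rule less)
    qed
    ultimately show ?thesis by simp
  qed
qed

section \<open>Matrices\<close>

lemma mat_trace_comm:
  fixes A B :: "'k::comm_semiring_0 mat"
  assumes "A \<in> carrier_mat n k" "B \<in> carrier_mat k n"
  shows "mat_trace (A * B) = mat_trace (B * A)"
proof -
  have "mat_trace (A * B) = (\<Sum>i<n. \<Sum>j<k. A $$ (i, j) * B $$ (j, i))"
    using assms unfolding mat_trace_def by (auto simp: scalar_prod_def lessThan_atLeast0 intro!: sum.cong)
  also have "\<dots> = (\<Sum>j<k. \<Sum>i<n. A $$ (i, j) * B $$ (j, i))" by (rule sum.swap)
  also have "\<dots> = mat_trace (B * A)"
    using assms unfolding mat_trace_def
    by (auto simp: scalar_prod_def lessThan_atLeast0 mult.commute intro!: sum.cong)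
  finally show ?thesis .
qed

lemma eq_mat_by_action:
  fixes A B :: "'k::semiring_1 mat"
  assumes "A \<in> carrier_mat n k" "B \<in> carrier_mat n k"
    and "\<And>v. v \<in> carrier_vec k \<Longrightarrow> A *\<^sub>v v = B *\<^sub>v v"
  shows "A = B"
proof (rule eq_matI)
  fix i j assume "i < dim_row B" "j < dim_col B"
  then have ij: "i < n" "j < k" using assms by auto
  have "(A *\<^sub>v unit_vec k j) $ i = (B *\<^sub>v unit_vec k j) $ i" using assms(3) by simp
  then show "A $$ (i, j) = B $$ (i, j)" using ij assms(1,2) by simp
qed (use assms in auto)

text \<open>
  Matrices of unspecified size have no common zero, so finite sums of them carry their dimensions.
\<close>

definition mat_sum :: "nat \<Rightarrow> nat \<Rightarrow> ('x \<Rightarrow> 'k::comm_monoid_add mat) \<Rightarrow> 'x set \<Rightarrow> 'k mat" where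
  "mat_sum n k F S = mat n k (\<lambda>(i, j). \<Sum>x\<in>S. F x $$ (i, j))"

lemma mat_sum_carrier [simp]: "mat_sum n k F S \<in> carrier_mat n k"
  by (simp add: mat_sum_def)

lemma mat_sum_dim [simp]: "dim_row (mat_sum n k F S) = n" "dim_col (mat_sum n k F S) = k"
  by (simp_all add: mat_sum_def)

lemma mat_sum_index [simp]: "i < n \<Longrightarrow> j < k \<Longrightarrow> mat_sum n k F S $$ (i, j) = (\<Sum>x\<in>S. F x $$ (i, j))"
  by (simp add: mat_sum_def)

lemma mat_sum_cong: "(\<And>x. x \<in> S \<Longrightarrow> F x = F' x) \<Longrightarrow> mat_sum n k F S = mat_sum n k F' S"
  by (simp add: mat_sum_def cong: sum.cong)

lemma mult_mat_sum:
  fixes A :: "'k::comm_semiring_1 mat"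
  assumes "A \<in> carrier_mat m n" "\<And>x. x \<in> S \<Longrightarrow> F x \<in> carrier_mat n k"
  shows "A * mat_sum n k F S = mat_sum m k (\<lambda>x. A * F x) S"
proof (rule eq_matI)
  fix i j assume ij: "i < dim_row (mat_sum m k (\<lambda>x. A * F x) S)" "j < dim_col (mat_sum m k (\<lambda>x. A * F x) S)"
  then have ij: "i < m" "j < k" by (auto simp: mat_sum_def)
  have "(A * mat_sum n k F S) $$ (i, j) = (\<Sum>l<n. A $$ (i, l) * (\<Sum>x\<in>S. F x $$ (l, j)))"
    using ij assms(1) by (auto simp: scalar_prod_def mat_sum_def lessThan_atLeast0 intro!: sum.cong)
  also have "\<dots> = (\<Sum>x\<in>S. \<Sum>l<n. A $$ (i, l) * F x $$ (l, j))"
    by (simp add: sum_distrib_left) (rule sum.swap)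
  also have "\<dots> = (\<Sum>x\<in>S. (A * F x) $$ (i, j))"
  proof (rule sum.cong[OF refl])
    fix x assume "x \<in> S"
    from assms(2)[OF this] show "(\<Sum>l<n. A $$ (i, l) * F x $$ (l, j)) = (A * F x) $$ (i, j)"
      using ij assms(1) by (auto simp: scalar_prod_def lessThan_atLeast0 intro!: sum.cong)
  qed
  finally show "(A * mat_sum n k F S) $$ (i, j) = mat_sum m k (\<lambda>x. A * F x) S $$ (i, j)" using ij by simp
qed (use assms in \<open>auto simp: mat_sum_def\<close>)

lemma mat_sum_mult:
  fixes A :: "'k::comm_semiring_1 mat"
  assumes "A \<in> carrier_mat k m" "\<And>x. x \<in> S \<Longrightarrow> F x \<in> carrier_mat n k"
  shows "mat_sum n k F S * A = mat_sum n m (\<lambda>x. F x * A) S"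
proof (rule eq_matI)
  fix i j assume ij: "i < dim_row (mat_sum n m (\<lambda>x. F x * A) S)" "j < dim_col (mat_sum n m (\<lambda>x. F x * A) S)"
  then have ij: "i < n" "j < m" by (auto simp: mat_sum_def)
  have "(mat_sum n k F S * A) $$ (i, j) = (\<Sum>l<k. (\<Sum>x\<in>S. F x $$ (i, l)) * A $$ (l, j))"
    using ij assms(1) by (auto simp: scalar_prod_def mat_sum_def lessThan_atLeast0 intro!: sum.cong)
  also have "\<dots> = (\<Sum>x\<in>S. \<Sum>l<k. F x $$ (i, l) * A $$ (l, j))"
    by (simp add: sum_distrib_right) (rule sum.swap)
  also have "\<dots> = (\<Sum>x\<in>S. (F x * A) $$ (i, j))"
  proof (rule sum.cong[OF refl])
    fix x assume "x \<in> S"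
    from assms(2)[OF this] show "(\<Sum>l<k. F x $$ (i, l) * A $$ (l, j)) = (F x * A) $$ (i, j)"
      using ij assms(1) by (auto simp: scalar_prod_def lessThan_atLeast0 intro!: sum.cong)
  qed
  finally show "(mat_sum n k F S * A) $$ (i, j) = mat_sum n m (\<lambda>x. F x * A) S $$ (i, j)" using ij by simp
qed (use assms in \<open>auto simp: mat_sum_def\<close>)

definition unit_mat :: "nat \<Rightarrow> nat \<Rightarrow> nat \<Rightarrow> nat \<Rightarrow> 'k::zero_neq_one mat" where
  "unit_mat n k i j = mat n k (\<lambda>q. if q = (i, j) then 1 else 0)"

lemma unit_mat_carrier [simp]: "unit_mat n k i j \<in> carrier_mat n k"
  by (simp add: unit_mat_def)

text \<open>
  The left-hand side is the trace of the operator \<open>Y \<mapsto> A Y B\<close> on matrices.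
\<close>

lemma trace_of_two_sided_mult:
  fixes A B :: "'k::comm_ring_1 mat"
  assumes A: "A \<in> carrier_mat n n" and B: "B \<in> carrier_mat k k"
  shows "(\<Sum>i<n. \<Sum>j<k. (A * unit_mat n k i j * B) $$ (i, j)) = mat_trace A * mat_trace B"
proof -
  have "(A * unit_mat n k i j * B) $$ (i, j) = A $$ (i, i) * B $$ (j, j)" if ij: "i < n" "j < k" for i j
  proof -
    have AE: "(A * unit_mat n k i j) $$ (i, l) = (if l = j then A $$ (i, i) else 0)" if "l < k" for l
    proof -
      have "(A * unit_mat n k i j) $$ (i, l) = (\<Sum>q<n. A $$ (i, q) * unit_mat n k i j $$ (q, l))"
        using that ij A by (auto simp: scalar_prod_def unit_mat_def lessThan_atLeast0 intro!: sum.cong)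
      also have "\<dots> = (\<Sum>q<n. if q = i then (if l = j then A $$ (i, i) else 0) else 0)"
        using that by (intro sum.cong refl) (auto simp: unit_mat_def)
      finally show ?thesis using ij by simp
    qed
    have "(A * unit_mat n k i j * B) $$ (i, j) = (\<Sum>l<k. (A * unit_mat n k i j) $$ (i, l) * B $$ (l, j))"
      using ij A B by (auto simp: scalar_prod_def unit_mat_def lessThan_atLeast0 intro!: sum.cong)
    also have "\<dots> = (\<Sum>l<k. if l = j then A $$ (i, i) * B $$ (j, j) else 0)"
      by (rule sum.cong) (auto simp: AE)
    finally show ?thesis using ij by simp
  qed
  then show ?thesis
    using A B by (simp add: mat_trace_def sum_product)
qed

definition mat_flat :: "'k::zero mat \<Rightarrow> nat \<times> nat \<Rightarrow> 'k" where
  "mat_flat M = (\<lambda>(i, j). if i < dim_row M \<and> j < dim_col M then M $$ (i, j) else 0)"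

lemma mat_mat_flat: "M \<in> carrier_mat n k \<Longrightarrow> mat n k (mat_flat M) = M"
  by (auto simp: mat_flat_def)

text \<open>
  A basis of the flattened image serves both to compute the trace and, turned back into matrices,
  as a basis in the sense of the module structure in which the dimension is defined.
\<close>

lemma trace_of_matrix_space_projection:
  fixes P :: "'k::field mat \<Rightarrow> 'k mat"
  assumes EC: "E \<subseteq> carrier_mat n k" and E0: "0\<^sub>m n k \<in> E"
    and Eadd: "\<And>A B. A \<in> E \<Longrightarrow> B \<in> E \<Longrightarrow> A + B \<in> E"
    and Esmult: "\<And>c A. A \<in> E \<Longrightarrow> c \<cdot>\<^sub>m A \<in> E"
    and Padd: "\<And>A B. A \<in> carrier_mat n k \<Longrightarrow> B \<in> carrier_mat n k \<Longrightarrow> P (A + B) = P A + P B"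
    and Psmult: "\<And>c A. A \<in> carrier_mat n k \<Longrightarrow> P (c \<cdot>\<^sub>m A) = c \<cdot>\<^sub>m P A"
    and into: "\<And>A. A \<in> carrier_mat n k \<Longrightarrow> P A \<in> E"
    and id: "\<And>A. A \<in> E \<Longrightarrow> P A = A"
  shows "(\<Sum>i<n. \<Sum>j<k. P (unit_mat n k i j) $$ (i, j)) =
      of_nat (vectorspace.dim class_ring ((module_mat TYPE('k) n k)\<lparr>carrier := E\<rparr>))"
    and "E \<noteq> {0\<^sub>m n k} \<Longrightarrow> vectorspace.dim class_ring ((module_mat TYPE('k) n k)\<lparr>carrier := E\<rparr>) > 0"
proof -
  let ?V = "module_mat TYPE('k) n k" and ?I = "{..<n} \<times> {..<k}"
  have EC': "A \<in> carrier_mat n k" if "A \<in> E" for A using that EC by auto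
  define P' where "P' = (\<lambda>f. mat_flat (P (mat n k f)))"
  have PC: "P A \<in> carrier_mat n k" if "A \<in> carrier_mat n k" for A using into[OF that] EC by auto
  have flat_add: "mat_flat (A + B) = mat_flat A + mat_flat B"
    if "A \<in> carrier_mat n k" "B \<in> carrier_mat n k" for A B :: "'k mat"
    using that by (auto simp: mat_flat_def fun_eq_iff)
  have flat_smult: "mat_flat (c \<cdot>\<^sub>m A) = fscale c (mat_flat A)" for c and A :: "'k mat"
    by (auto simp: mat_flat_def fun_eq_iff fscale_def)
  have lin: "Vector_Spaces.linear fscale fscale P'"
  proof (unfold_locales, goal_cases)
    case (1 x y)
    have "mat n k (x + y) = mat n k x + mat n k y" by auto
    then show ?case by (simp add: P'_def Padd flat_add PC)
  next
    case (2 c x)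
    have "mat n k (fscale c x) = c \<cdot>\<^sub>m mat n k x" by (auto simp: fscale_def)
    then show ?case by (simp add: P'_def Psmult flat_smult PC)
  qed
  have sub: "fun_vs.subspace (mat_flat ` E)"
  proof (rule fun_vs.subspaceI)
    show "0 \<in> mat_flat ` E"
      by (rule image_eqI[OF _ E0]) (auto simp: mat_flat_def fun_eq_iff)
    show "x + y \<in> mat_flat ` E" if xy: "x \<in> mat_flat ` E" "y \<in> mat_flat ` E" for x y
      using xy flat_add Eadd EC' by (auto simp flip: flat_add)
    show "fscale c x \<in> mat_flat ` E" if "x \<in> mat_flat ` E" for c x
      using that Esmult by (auto simp flip: flat_smult)
  qed
  obtain B where B: "B \<subseteq> mat_flat ` E" "fun_vs.independent B" "mat_flat ` E \<subseteq> fun_vs.span B"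
    using fun_vs.maximal_independent_subset by blast
  have spanB: "fun_vs.span B = mat_flat ` E"
    using B(3) fun_vs.span_minimal[OF B(1) sub] by blast
  have supp: "f q = 0" if f: "f \<in> mat_flat ` E" and q: "q \<notin> ?I" for f q
  proof -
    obtain A where "A \<in> carrier_mat n k" "f = mat_flat A" using f EC' by auto
    then show ?thesis using q by (auto simp: mat_flat_def split: prod.split)
  qed
  have unit: "mat n k (kronecker (i, j)) = unit_mat n k i j" for i j
    by (auto simp: unit_mat_def kronecker_def)
  have Pk: "P' (kronecker (i, j)) = mat_flat (P (unit_mat n k i j))" for i j
    by (simp add: P'_def unit)
  have fin: "finite B" and tr: "(\<Sum>q\<in>?I. P' (kronecker q) q) = of_nat (card B)"
  proof -
    have "P' (kronecker q) \<in> mat_flat ` E" for q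
      using into by (cases q) (simp add: Pk)
    moreover have "P' f = f" if "f \<in> mat_flat ` E" for f
      using that EC' by (auto simp: P'_def mat_mat_flat id)
    ultimately show "finite B" "(\<Sum>q\<in>?I. P' (kronecker q) q) = of_nat (card B)"
      using trace_of_projection[where P = P' and I = ?I and E = "mat_flat ` E" and B = B]
        lin supp sub B(2) spanB by auto
  qed
  have cardB: "card B = vectorspace.dim class_ring (?V\<lparr>carrier := E\<rparr>)"
  proof -
    interpret V: vectorspace class_ring ?V by (rule matrix_vs)
    have "VectorSpace.subspace class_ring E ?V"
      unfolding VectorSpace.subspace_def submodule_def
      using V.vectorspace_axioms V.module_axioms EC E0 Eadd Esmult by (auto simp: module_mat_simps)
    then interpret E: vectorspace class_ring "?V\<lparr>carrier := E\<rparr>"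
      by (rule V.subspace_is_vs)
    have fs: "(finsum (?V\<lparr>carrier := E\<rparr>) F A) $$ (i, j) = (\<Sum>x\<in>A. F x $$ (i, j))"
      if "finite A" "F \<in> A \<rightarrow> E" "i < n" "j < k" for F i j and A :: "'k mat set"
      using that(1,2)
    proof (induction A)
      case empty
      show ?case using that by (simp add: module_mat_simps)
    next
      case (insert x A)
      have "finsum (?V\<lparr>carrier := E\<rparr>) F A \<in> E"
        using E.finsum_closed[of F A] insert by auto
      then show ?case
        using insert that(3,4) EC'[of "finsum (?V\<lparr>carrier := E\<rparr>) F A"]
        by (auto simp: E.finsum_insert module_mat_simps)
    qed
    let ?B = "mat n k ` B"
    have BC: "mat_flat (mat n k b) = b" "mat n k b \<in> E" if "b \<in> B" for b
      using that B(1) EC' by (auto simp: mat_mat_flat)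
    have inj: "inj_on (mat n k) B" using BC by (metis inj_onI)
    have lc: "(E.lincomb a ?B) $$ (i, j) = (\<Sum>b\<in>B. a (mat n k b) * b (i, j))"
      if "i < n" "j < k" for a i j
    proof -
      have "(E.lincomb a ?B) $$ (i, j) = (\<Sum>M\<in>?B. (a M \<cdot>\<^sub>m M) $$ (i, j))"
        unfolding E.lincomb_def using fin that BC Esmult by (subst fs) (auto simp: module_mat_simps)
      also have "\<dots> = (\<Sum>b\<in>B. a (mat n k b) * b (i, j))"
        using that by (simp add: sum.reindex[OF inj])
      finally show ?thesis .
    qed
    have lcE: "E.lincomb a ?B \<in> E" for a
      using E.lincomb_closed[of ?B a] BC by (auto simp: image_subset_iff)
    have "E.lin_indpt ?B"
    \<comment> \<open>A relation between the matrices is, entry by entry, a relation between the functions.\<close>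
    proof (rule E.finite_lin_indpt2)
      show "finite ?B" using fin by simp
      show "?B \<subseteq> carrier (?V\<lparr>carrier := E\<rparr>)" using BC by auto
      fix a assume "E.lincomb a ?B = \<zero>\<^bsub>?V\<lparr>carrier := E\<rparr>\<^esub>"
      then have z: "E.lincomb a ?B = 0\<^sub>m n k" by (simp add: module_mat_simps)
      have "(\<Sum>b\<in>B. fscale (a (mat n k b)) b) = 0"
      proof
        fix q :: "nat \<times> nat"
        obtain i j where q: "q = (i, j)" by force
        have *: "(\<Sum>b\<in>B. fscale (a (mat n k b)) b) q = (\<Sum>b\<in>B. a (mat n k b) * b (i, j))"
          by (simp add: sum_fun_apply fscale_def q)
        show "(\<Sum>b\<in>B. fscale (a (mat n k b)) b) q = 0 q"
        proof (cases "i < n \<and> j < k")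
          case True then show ?thesis using lc[of i j a] z * by simp
        next
          case False
          then have "b (i, j) = 0" if "b \<in> B" for b
            using supp[of b "(i, j)"] B(1) that by auto
          then show ?thesis unfolding * by simp
        qed
      qed
      then have "a (mat n k b) = 0" if "b \<in> B" for b
        using fun_vs.independentD[where u = "\<lambda>b. a (mat n k b)", OF B(2) fin order_refl _ that] by blast
      then show "\<forall>v\<in>?B. a v = \<zero>\<^bsub>class_ring\<^esub>" by auto
    qed
    moreover have "E.gen_set ?B"
    proof
      show "E.span ?B \<subseteq> carrier (?V\<lparr>carrier := E\<rparr>)"
        using BC by (intro E.span_is_subset2) auto
      show "carrier (?V\<lparr>carrier := E\<rparr>) \<subseteq> E.span ?B"
      proof
        fix M assume "M \<in> carrier (?V\<lparr>carrier := E\<rparr>)"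
        then have M: "M \<in> E" by simp
        let ?r = "fun_vs.representation B (mat_flat M)"
        have r: "mat_flat M = (\<Sum>b\<in>B. fscale (?r b) b)"
          using fun_vs.sum_representation_eq[OF B(2) _ fin order_refl, of "mat_flat M"] M spanB by simp
        have "M = E.lincomb (\<lambda>A. ?r (mat_flat A)) ?B"
        proof (rule eq_matI)
          fix i j assume "i < dim_row (E.lincomb (\<lambda>A. ?r (mat_flat A)) ?B)"
            "j < dim_col (E.lincomb (\<lambda>A. ?r (mat_flat A)) ?B)"
          then have ij: "i < n" "j < k"
            by (simp_all only: carrier_matD[OF EC'[OF lcE]])
          have "M $$ (i, j) = mat_flat M (i, j)" using ij EC'[OF M] by (auto simp: mat_flat_def)
          also have "\<dots> = (\<Sum>b\<in>B. ?r b * b (i, j))"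
            using fun_cong[OF r, of "(i, j)"] by (simp add: sum_fun_apply fscale_def)
          finally show "M $$ (i, j) = E.lincomb (\<lambda>A. ?r (mat_flat A)) ?B $$ (i, j)"
            using ij BC by (simp add: lc cong: sum.cong)
        qed (simp_all only: carrier_matD[OF EC'[OF M]] carrier_matD[OF EC'[OF lcE]])
        then show "M \<in> E.span ?B"
          unfolding E.span_def using fin by (auto intro!: exI[of _ "\<lambda>A. ?r (mat_flat A)"] exI[of _ ?B])
      qed
    qed
    ultimately have "E.basis ?B" unfolding E.basis_def using BC by auto
    then show ?thesis using E.dim_basis[of ?B] fin card_image[OF inj] by simp
  qed
  have "(\<Sum>i<n. \<Sum>j<k. P (unit_mat n k i j) $$ (i, j)) = (\<Sum>i<n. \<Sum>j<k. P' (kronecker (i, j)) (i, j))"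
    using carrier_matD[OF PC[OF unit_mat_carrier]] by (intro sum.cong refl) (auto simp: Pk mat_flat_def)
  also have "\<dots> = of_nat (card B)"
    using tr by (simp add: sum.cartesian_product case_prod_unfold)
  finally show "(\<Sum>i<n. \<Sum>j<k. P (unit_mat n k i j) $$ (i, j)) =
      of_nat (vectorspace.dim class_ring (?V\<lparr>carrier := E\<rparr>))" unfolding cardB .
  show "vectorspace.dim class_ring (?V\<lparr>carrier := E\<rparr>) > 0" if E: "E \<noteq> {0\<^sub>m n k}"
  proof (rule ccontr)
    assume "\<not> vectorspace.dim class_ring (?V\<lparr>carrier := E\<rparr>) > 0"
    then have "B = {}" using cardB fin by simp
    then have z: "mat_flat ` E = {0}" using spanB by simp
    have "A = 0\<^sub>m n k" if A: "A \<in> E" for A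
    proof -
      have "mat_flat A = 0" using z A by blast
      then have "mat n k (mat_flat A) = 0\<^sub>m n k" by auto
      then show ?thesis using mat_mat_flat[OF EC'[OF A]] by simp
    qed
    then show False using E E0 by blast
  qed
qed

section \<open>Irreducible representations of a maximal subgroup\<close>

lemma vec_subspace_image:
  fixes A :: "'k::field mat"
  assumes A: "A \<in> carrier_mat n k"
  shows "vec_subspace n ((\<lambda>v. A *\<^sub>v v) ` carrier_vec k)"
  unfolding vec_subspace_def
proof (intro conjI ballI allI)
  show "0\<^sub>v n \<in> (\<lambda>v. A *\<^sub>v v) ` carrier_vec k"
    by (rule image_eqI[of _ _ "0\<^sub>v k"]) (use A in auto)
  show "v + w \<in> (\<lambda>v. A *\<^sub>v v) ` carrier_vec k"
    if vw: "v \<in> (\<lambda>v. A *\<^sub>v v) ` carrier_vec k" "w \<in> (\<lambda>v. A *\<^sub>v v) ` carrier_vec k" for v w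
    using vw by (auto simp flip: mult_add_distrib_mat_vec[OF A])
  show "c \<cdot>\<^sub>v v \<in> (\<lambda>v. A *\<^sub>v v) ` carrier_vec k"
    if v: "v \<in> (\<lambda>v. A *\<^sub>v v) ` carrier_vec k" for c v
    using v by (auto simp flip: mult_mat_vec[OF A])
qed (use A in auto)

lemma vec_subspace_kernel:
  fixes A :: "'k::field mat"
  assumes A: "A \<in> carrier_mat n k"
  shows "vec_subspace k {v \<in> carrier_vec k. A *\<^sub>v v = 0\<^sub>v n}"
  unfolding vec_subspace_def
  using A by (auto simp: mult_add_distrib_mat_vec[OF A] mult_mat_vec[OF A])

locale irreducible_subgroup_rep =
  fixes e :: "'s::{finite,inverse_semigroup}" and n :: nat and \<phi> :: "'s \<Rightarrow> 'k::field_char_0 mat"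
  assumes e: "e \<in> idempotents"
    and irr: "irreducible_rep (carrier (max_subgroup e)) n \<phi>"
begin

abbreviation "G \<equiv> carrier (max_subgroup e)"

lemma phi_carrier [simp]: "g \<in> G \<Longrightarrow> \<phi> g \<in> carrier_mat n n"
  and phi_mult: "g \<in> G \<Longrightarrow> h \<in> G \<Longrightarrow> \<phi> (g * h) = \<phi> g * \<phi> h"
  using irr unfolding irreducible_rep_def matrix_rep_def by auto

lemma phi_irreducible:
  assumes "vec_subspace n W" "\<And>g w. g \<in> G \<Longrightarrow> w \<in> W \<Longrightarrow> \<phi> g *\<^sub>v w \<in> W"
  shows "W = {0\<^sub>v n} \<or> W = carrier_vec n"
  using irr assms unfolding irreducible_rep_def invariant_subspace_iff by blast

lemma one_in_G [simp]: "e \<in> G"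
  by (rule max_subgroup_one[OF e])

text \<open>
  The image of \<open>\<phi> e\<close> is an invariant subspace, and it is nonzero as \<open>\<phi>\<close> does not vanish
  identically. So the idempotent matrix \<open>\<phi> e\<close> is surjective.
\<close>

lemma phi_one: "\<phi> e = 1\<^sub>m n"
proof -
  let ?W = "(\<lambda>v. \<phi> e *\<^sub>v v) ` carrier_vec n"
  have ge: "\<phi> g = \<phi> e * \<phi> g" "\<phi> g = \<phi> g * \<phi> e" if "g \<in> G" for g
    using phi_mult[of e g] phi_mult[of g e] max_subgroupD[OF that] that by auto
  have "?W = {0\<^sub>v n} \<or> ?W = carrier_vec n"
  proof (rule phi_irreducible[OF vec_subspace_image[OF phi_carrier[OF one_in_G]]])
    fix g w assume g: "g \<in> G" and "w \<in> ?W"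
    then obtain v where v: "v \<in> carrier_vec n" "w = \<phi> e *\<^sub>v v" by auto
    have "\<phi> g *\<^sub>v w = (\<phi> g * \<phi> e) *\<^sub>v v"
      using g v by (simp add: assoc_mult_mat_vec[OF phi_carrier phi_carrier])
    also have "\<dots> = (\<phi> e * \<phi> g) *\<^sub>v v" using ge[OF g] by simp
    also have "\<dots> = \<phi> e *\<^sub>v (\<phi> g *\<^sub>v v)"
      using g v by (simp add: assoc_mult_mat_vec[OF phi_carrier phi_carrier])
    finally show "\<phi> g *\<^sub>v w \<in> ?W"
      using g v by (auto intro!: image_eqI[of _ _ "\<phi> g *\<^sub>v v"] mult_mat_vec_carrier)
  qed
  moreover have "?W \<noteq> {0\<^sub>v n}"
  proof
    assume z: "?W = {0\<^sub>v n}"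
    obtain s where s: "s \<in> G" "\<phi> s \<noteq> 0\<^sub>m n n" using irr unfolding irreducible_rep_def by auto
    have "\<phi> s = 0\<^sub>m n n"
    proof (rule eq_mat_by_action)
      fix v :: "'k vec" assume v: "v \<in> carrier_vec n"
      have "\<phi> s *\<^sub>v v = \<phi> e *\<^sub>v (\<phi> s *\<^sub>v v)"
        using ge(1)[OF s(1)] s v by (metis assoc_mult_mat_vec phi_carrier one_in_G)
      also have "\<dots> \<in> ?W"
        using v s mult_mat_vec_carrier[OF phi_carrier] by (intro imageI) auto
      finally have "\<phi> s *\<^sub>v v = 0\<^sub>v n" using z by auto
      then show "\<phi> s *\<^sub>v v = 0\<^sub>m n n *\<^sub>v v" using v by (auto intro!: eq_vecI)
    qed (use s in auto)
    with s show False by simp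
  qed
  ultimately have W: "?W = carrier_vec n" by blast
  show ?thesis
  proof (rule eq_mat_by_action)
    fix v :: "'k vec" assume "v \<in> carrier_vec n"
    then obtain w where w: "w \<in> carrier_vec n" "v = \<phi> e *\<^sub>v w" using W by auto
    then have "\<phi> e *\<^sub>v v = (\<phi> e * \<phi> e) *\<^sub>v w"
      by (simp add: assoc_mult_mat_vec[OF phi_carrier phi_carrier])
    also have "\<dots> = v" using ge(1)[OF one_in_G] w(2) by simp
    finally show "\<phi> e *\<^sub>v v = 1\<^sub>m n *\<^sub>v v" using \<open>v \<in> carrier_vec n\<close> by simp
  qed auto
qed

lemma n_pos: "n > 0"
proof (rule ccontr)
  assume "\<not> n > 0"
  obtain s where "s \<in> G" "\<phi> s \<noteq> 0\<^sub>m n n" using irr unfolding irreducible_rep_def by auto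
  with \<open>\<not> n > 0\<close> phi_carrier[of s] show False by (auto intro: eq_matI)
qed

lemma sinv_G [simp]: "g \<in> G \<Longrightarrow> sinv g \<in> G"
  by (rule max_subgroupD)

lemma mult_G [simp]: "g \<in> G \<Longrightarrow> h \<in> G \<Longrightarrow> g * h \<in> G"
  by (rule max_subgroup_mult)

lemma phi_sinv: "g \<in> G \<Longrightarrow> \<phi> g * \<phi> (sinv g) = 1\<^sub>m n" "g \<in> G \<Longrightarrow> \<phi> (sinv g) * \<phi> g = 1\<^sub>m n"
  using phi_mult[of g "sinv g"] phi_mult[of "sinv g" g] max_subgroupD[of g e] by (auto simp: phi_one)

lemma trace_phi_conjugate:
  assumes "g \<in> G" "q \<in> G"
  shows "mat_trace (\<phi> (q * g * sinv q)) = mat_trace (\<phi> g)"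
proof -
  have "mat_trace (\<phi> (q * g * sinv q)) = mat_trace (\<phi> q * (\<phi> g * \<phi> (sinv q)))"
    using assms by (simp add: phi_mult mult.assoc)
  also have "\<dots> = mat_trace ((\<phi> g * \<phi> (sinv q)) * \<phi> q)"
    by (rule mat_trace_comm[of _ n n]) (use assms in \<open>auto intro!: mult_carrier_mat[of _ n n]\<close>)
  also have "(\<phi> g * \<phi> (sinv q)) * \<phi> q = \<phi> g * (\<phi> (sinv q) * \<phi> q)"
    by (rule assoc_mult_mat[of _ n n _ n _ n]) (use assms in auto)
  finally show ?thesis using assms by (simp add: phi_sinv right_mult_one_mat[OF phi_carrier])
qed

text \<open>
  For a representation \<open>\<sigma>\<close> of the maximal subgroup, \<open>Y \<mapsto> group_average N \<sigma> Y\<close> maps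
  all matrices to homomorphisms from \<open>\<phi>\<close> to \<open>\<sigma>\<close>.
\<close>

definition group_average :: "nat \<Rightarrow> ('s \<Rightarrow> 'k mat) \<Rightarrow> 'k mat \<Rightarrow> 'k mat" where
  "group_average N \<sigma> Y = (1 / of_nat (card G)) \<cdot>\<^sub>m mat_sum N n (\<lambda>g. \<sigma> g * Y * \<phi> (sinv g)) G"

lemma group_average_carrier [simp]: "group_average N \<sigma> Y \<in> carrier_mat N n"
  by (simp add: group_average_def)

lemma sandwich_carrier:
  assumes "A \<in> carrier_mat N N" "Y \<in> carrier_mat N n" "g \<in> G"
  shows "A * Y * \<phi> (sinv g) \<in> carrier_mat N n"
  using assms by (intro mult_carrier_mat[of _ N n] mult_carrier_mat[of _ N N]) auto

lemma card_G: "(of_nat (card G) :: 'k) \<noteq> 0"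
  by (simp add: card_eq_0_iff) (metis empty_iff one_in_G)

lemma group_average_intertwines:
  assumes rep: "matrix_rep G N \<sigma>" and Y: "Y \<in> carrier_mat N n" and h: "h \<in> G"
  shows "\<sigma> h * group_average N \<sigma> Y = group_average N \<sigma> Y * \<phi> h"
proof -
  have sc: "\<sigma> g \<in> carrier_mat N N" if "g \<in> G" for g using rep that by (auto simp: matrix_rep_def)
  have sm: "\<sigma> (g * k) = \<sigma> g * \<sigma> k" if "g \<in> G" "k \<in> G" for g k
    using rep that by (auto simp: matrix_rep_def)
  let ?F = "\<lambda>g. \<sigma> g * Y * \<phi> (sinv g)"
  have FC: "?F g \<in> carrier_mat N n" if "g \<in> G" for g
    using sandwich_carrier[OF sc[OF that] Y that] .
  have bij: "bij_betw (\<lambda>g. h * g) G G"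
  proof (rule bij_betwI[where g = "\<lambda>g. sinv h * g"])
    show "sinv h * (h * g) = g" if "g \<in> G" for g
      using max_subgroupD[OF h] max_subgroupD[OF that] by (simp flip: mult.assoc)
    show "h * (sinv h * g) = g" if "g \<in> G" for g
      using max_subgroupD[OF h] max_subgroupD[OF that] by (simp flip: mult.assoc)
  qed (use h in auto)
  have "\<sigma> h * mat_sum N n ?F G = mat_sum N n (\<lambda>g. \<sigma> h * ?F g) G"
    by (rule mult_mat_sum) (use sc h FC in auto)
  also have "\<dots> = mat_sum N n (\<lambda>g. ?F (h * g) * \<phi> h) G"
  proof (rule mat_sum_cong)
    fix g assume g: "g \<in> G"
    have 1: "\<phi> (sinv (h * g)) * \<phi> h = \<phi> (sinv g)"
      using g h phi_mult[of "sinv g * sinv h" h] max_subgroupD[OF h] max_subgroupD[OF g]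
      by (simp add: sinv_mult mult.assoc)
    have c: "\<sigma> (h * g) * Y \<in> carrier_mat N n" "\<sigma> g * Y \<in> carrier_mat N n"
      using sc[of "h * g"] sc[of g] g h Y by auto
    have "?F (h * g) * \<phi> h = \<sigma> (h * g) * Y * (\<phi> (sinv (h * g)) * \<phi> h)"
      by (rule assoc_mult_mat[of _ N n _ n _ n]) (use g h c in auto)
    also have "\<dots> = \<sigma> h * \<sigma> g * Y * \<phi> (sinv g)" using g h sm 1 by simp
    also have "\<sigma> h * \<sigma> g * Y = \<sigma> h * (\<sigma> g * Y)" by (rule assoc_mult_mat[of _ N N _ N _ n]) (use sc g h Y in auto)
    also have "\<sigma> h * (\<sigma> g * Y) * \<phi> (sinv g) = \<sigma> h * ?F g"
      by (rule assoc_mult_mat[of _ N N _ n _ n]) (use sc g h c in auto)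
    finally show "\<sigma> h * ?F g = ?F (h * g) * \<phi> h" by simp
  qed
  also have "\<dots> = mat_sum N n (\<lambda>g. ?F g * \<phi> h) G"
    unfolding mat_sum_def using sum.reindex_bij_betw[OF bij, of "\<lambda>g. (?F g * \<phi> h) $$ (i, j)" for i j]
    by simp
  also have "\<dots> = mat_sum N n ?F G * \<phi> h"
    by (rule mat_sum_mult[symmetric]) (use h FC in auto)
  finally show ?thesis
    unfolding group_average_def
    by (simp add: mult_smult_distrib[OF sc[OF h] mat_sum_carrier]
        mult_smult_assoc_mat[OF mat_sum_carrier phi_carrier[OF h]])
qed

lemma group_average_add:
  assumes rep: "matrix_rep G N \<sigma>" and YZ: "Y \<in> carrier_mat N n" "Z \<in> carrier_mat N n"
  shows "group_average N \<sigma> (Y + Z) = group_average N \<sigma> Y + group_average N \<sigma> Z"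
proof -
  have sc: "\<sigma> g \<in> carrier_mat N N" if "g \<in> G" for g using rep that by (auto simp: matrix_rep_def)
  have "\<sigma> g * (Y + Z) * \<phi> (sinv g) = \<sigma> g * Y * \<phi> (sinv g) + \<sigma> g * Z * \<phi> (sinv g)" if g: "g \<in> G" for g
  proof -
    have "\<sigma> g * (Y + Z) = \<sigma> g * Y + \<sigma> g * Z" using sc[OF g] YZ by (rule mult_add_distrib_mat)
    then show ?thesis using sc[OF g] YZ g by (auto intro!: add_mult_distrib_mat[of _ N n _ _ n])
  qed
  moreover have "\<sigma> g * Y * \<phi> (sinv g) \<in> carrier_mat N n" "\<sigma> g * Z * \<phi> (sinv g) \<in> carrier_mat N n" if "g \<in> G" for g
    using sandwich_carrier[OF sc[OF that]] YZ that by auto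
  moreover have "dim_row (\<sigma> g) = N" "dim_col (\<phi> (sinv g)) = n" if "g \<in> G" for g
    using sc[OF that] phi_carrier[OF sinv_G[OF that]] by auto
  ultimately show ?thesis
    by (auto simp: group_average_def mat_sum_def sum.distrib algebra_simps sum_divide_distrib
        add_divide_distrib intro!: eq_matI cong: sum.cong)
qed

lemma group_average_smult:
  assumes rep: "matrix_rep G N \<sigma>" and Y: "Y \<in> carrier_mat N n"
  shows "group_average N \<sigma> (c \<cdot>\<^sub>m Y) = c \<cdot>\<^sub>m group_average N \<sigma> Y"
proof -
  have sc: "\<sigma> g \<in> carrier_mat N N" if "g \<in> G" for g using rep that by (auto simp: matrix_rep_def)
  have "\<sigma> g * (c \<cdot>\<^sub>m Y) * \<phi> (sinv g) = c \<cdot>\<^sub>m (\<sigma> g * Y * \<phi> (sinv g))" if g: "g \<in> G" for g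
  proof -
    have "\<sigma> g * (c \<cdot>\<^sub>m Y) = c \<cdot>\<^sub>m (\<sigma> g * Y)" using sc[OF g] Y by (rule mult_smult_distrib)
    then show ?thesis using sc[OF g] Y g by (auto intro!: mult_smult_assoc_mat[of _ N n _ n])
  qed
  moreover have "\<sigma> g * Y * \<phi> (sinv g) \<in> carrier_mat N n" if "g \<in> G" for g
    using sandwich_carrier[OF sc[OF that] Y that] .
  moreover have "dim_row (\<sigma> g) = N" "dim_col (\<phi> (sinv g)) = n" if "g \<in> G" for g
    using sc[OF that] phi_carrier[OF sinv_G[OF that]] by auto
  ultimately show ?thesis
    by (auto simp: group_average_def mat_sum_def sum_distrib_left mult.left_commute
        intro!: eq_matI cong: sum.cong)
qed

text \<open>
  Every summand of the average is a two-sided multiplication. The factor \<open>Z\<close> allows averaging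
  after a fixed operator, later the image of the Moebius sum of idempotents.
\<close>

lemma trace_group_average:
  assumes rep: "matrix_rep G N \<sigma>" and Z: "Z \<in> carrier_mat N N"
  shows "(\<Sum>i<N. \<Sum>j<n. group_average N \<sigma> (Z * unit_mat N n i j) $$ (i, j)) =
    1 / of_nat (card G) * (\<Sum>g\<in>G. mat_trace (\<phi> (sinv g)) * mat_trace (\<sigma> g * Z))"
proof -
  have sc: "\<sigma> g \<in> carrier_mat N N" if "g \<in> G" for g using rep that by (auto simp: matrix_rep_def)
  let ?A = "\<lambda>g i j. \<sigma> g * (Z * unit_mat N n i j) * \<phi> (sinv g)"
  have A: "?A g i j = (\<sigma> g * Z) * unit_mat N n i j * \<phi> (sinv g)" if "g \<in> G" for g i j
    by (subst assoc_mult_mat[of "\<sigma> g" N N Z N "unit_mat N n i j" n]) (use sc[OF that] Z in auto)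
  have "(\<Sum>i<N. \<Sum>j<n. group_average N \<sigma> (Z * unit_mat N n i j) $$ (i, j)) =
      (\<Sum>i<N. \<Sum>j<n. 1 / of_nat (card G) * (\<Sum>g\<in>G. ?A g i j $$ (i, j)))"
    by (intro sum.cong refl) (auto simp: group_average_def)
  also have "\<dots> = 1 / of_nat (card G) * (\<Sum>i<N. \<Sum>j<n. \<Sum>g\<in>G. ?A g i j $$ (i, j))"
    by (simp only: sum_distrib_left)
  also have "(\<Sum>i<N. \<Sum>j<n. \<Sum>g\<in>G. ?A g i j $$ (i, j)) = (\<Sum>i<N. \<Sum>g\<in>G. \<Sum>j<n. ?A g i j $$ (i, j))"
    by (intro sum.cong refl sum.swap)
  also have "\<dots> = (\<Sum>g\<in>G. \<Sum>i<N. \<Sum>j<n. ?A g i j $$ (i, j))"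
    by (rule sum.swap)
  also have "\<dots> = (\<Sum>g\<in>G. mat_trace (\<phi> (sinv g)) * mat_trace (\<sigma> g * Z))"
  proof (rule sum.cong[OF refl])
    fix g assume g: "g \<in> G"
    have "(\<Sum>i<N. \<Sum>j<n. ?A g i j $$ (i, j)) = mat_trace (\<sigma> g * Z) * mat_trace (\<phi> (sinv g))"
      unfolding A[OF g] by (rule trace_of_two_sided_mult) (use sc[OF g] Z g in auto)
    then show "(\<Sum>i<N. \<Sum>j<n. ?A g i j $$ (i, j)) = mat_trace (\<phi> (sinv g)) * mat_trace (\<sigma> g * Z)"
      by simp
  qed
  finally show ?thesis .
qed

lemma rep_phi: "matrix_rep G n \<phi>"
  by (auto simp: matrix_rep_def phi_mult)

text \<open>
  For \<open>\<sigma> = \<phi>\<close> the average is a projection onto the endomorphism algebra, so its trace is the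
  dimension of that algebra. The dimension is positive because the identity is an endomorphism.
\<close>

lemma norm_character:
  "1 / of_nat (card G) * (\<Sum>g\<in>G. mat_trace (\<phi> (sinv g)) * mat_trace (\<phi> g)) =
     of_nat (endomorphism_dim G n \<phi>)"
  and endomorphism_dim_pos: "endomorphism_dim G n \<phi> > 0"
proof -
  let ?E = "endomorphism_algebra G n \<phi>" and ?P = "group_average n \<phi>"
  have into: "?P A \<in> ?E" if "A \<in> carrier_mat n n" for A
      using group_average_intertwines[OF rep_phi that] by (auto simp: endomorphism_algebra_def)
  have id: "?P A = A" if A: "A \<in> ?E" for A
    proof -
      have Ac: "A \<in> carrier_mat n n" using A by (simp add: endomorphism_algebra_def)
      have "\<phi> g * A * \<phi> (sinv g) = A" if g: "g \<in> G" for g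
      proof -
        have "\<phi> g * A = A * \<phi> g" using A g by (simp add: endomorphism_algebra_def)
        then have "\<phi> g * A * \<phi> (sinv g) = A * (\<phi> g * \<phi> (sinv g))"
          using Ac g by (simp add: assoc_mult_mat[OF Ac phi_carrier phi_carrier])
        then show ?thesis using Ac g by (simp add: phi_sinv)
      qed
      then have "?P A = (1 / of_nat (card G)) \<cdot>\<^sub>m mat_sum n n (\<lambda>g. A) G"
        unfolding group_average_def by (simp cong: mat_sum_cong)
      also have "\<dots> = A"
        using Ac card_G by (intro eq_matI) (auto simp: mat_sum_def simp del: one_in_G)
      finally show ?thesis .
    qed
  have E: "?E \<subseteq> carrier_mat n n" "0\<^sub>m n n \<in> ?E" "\<And>A B. A \<in> ?E \<Longrightarrow> B \<in> ?E \<Longrightarrow> A + B \<in> ?E"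
    "\<And>c A. A \<in> ?E \<Longrightarrow> c \<cdot>\<^sub>m A \<in> ?E"
    by (auto simp: endomorphism_algebra_def add_mult_distrib_mat[OF _ _ phi_carrier]
      mult_add_distrib_mat[OF phi_carrier] mult_smult_distrib[OF phi_carrier] mult_smult_assoc_mat[OF _ phi_carrier]
      left_mult_zero_mat[OF phi_carrier] right_mult_zero_mat[OF phi_carrier])
  note projection = trace_of_matrix_space_projection[where P = ?P, OF E
      group_average_add[OF rep_phi] group_average_smult[OF rep_phi] into id, folded endomorphism_dim_def]
  have "1\<^sub>m n \<in> ?E"
    by (auto simp: endomorphism_algebra_def left_mult_one_mat[OF phi_carrier] right_mult_one_mat[OF phi_carrier])
  moreover have "(1\<^sub>m n :: 'k mat) \<noteq> 0\<^sub>m n n"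
  proof
    assume "(1\<^sub>m n :: 'k mat) = 0\<^sub>m n n"
    then have "(1\<^sub>m n :: 'k mat) $$ (0, 0) = 0\<^sub>m n n $$ (0, 0)" by simp
    then show False using n_pos by simp
  qed
  ultimately show "endomorphism_dim G n \<phi> > 0" using projection(2) by blast
  have "(\<Sum>i<n. \<Sum>j<n. ?P (unit_mat n n i j) $$ (i, j)) = of_nat (endomorphism_dim G n \<phi>)"
    by (rule projection(1))
  moreover have "(\<Sum>i<n. \<Sum>j<n. ?P (unit_mat n n i j) $$ (i, j)) =
     1 / of_nat (card G) * (\<Sum>g\<in>G. mat_trace (\<phi> (sinv g)) * mat_trace (\<phi> g))"
    using trace_group_average[OF rep_phi one_carrier_mat]
    by (simp add: right_mult_one_mat[OF phi_carrier] left_mult_one_mat[OF unit_mat_carrier] cong: sum.cong)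
  ultimately show "1 / of_nat (card G) * (\<Sum>g\<in>G. mat_trace (\<phi> (sinv g)) * mat_trace (\<phi> g)) =
     of_nat (endomorphism_dim G n \<phi>)" by simp
qed

end

section \<open>The induced representation\<close>

lemma sum_blocks: "(\<Sum>i<m * n. F i) = (\<Sum>a<m. \<Sum>b<n. F (a * n + b))" for n :: nat
proof -
  have "(\<Sum>i<m * n. F i) = (\<Sum>a<m. sum F {a * n..<a * n + n})" by (rule sum.nat_group[symmetric])
  also have "\<dots> = (\<Sum>a<m. \<Sum>b<n. F (a * n + b))"
  proof (rule sum.cong[OF refl])
    fix a show "sum F {a * n..<a * n + n} = (\<Sum>b<n. F (a * n + b))"
      using sum.shift_bounds_nat_ivl[of F 0 "a * n" n] by (simp add: lessThan_atLeast0 add.commute)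
  qed
  finally show ?thesis .
qed

lemma block_index:
  fixes n :: nat
  assumes "a < m" "b < n"
  shows "a * n + b < m * n" "(a * n + b) div n = a" "(a * n + b) mod n = b"
proof -
  have "a * n + b < a * n + n" using assms by simp
  also have "\<dots> = Suc a * n" by simp
  also have "\<dots> \<le> m * n" using assms(1) by (intro mult_le_mono1) simp
  finally show "a * n + b < m * n" .
qed (use assms in auto)

lemma block_index_cases:
  fixes n :: nat
  assumes "c < m * n"
  obtains a b where "a < m" "b < n" "c = a * n + b"
proof
  have "n > 0" using assms by (cases n) auto
  then show "c div n < m" "c mod n < n" "c = c div n * n + c mod n"
    using assms by (auto simp: less_mult_imp_div_less)
qed

lemma mult_mat_zero_vec:
  fixes A :: "'a::semiring_0 mat"
  shows "A \<in> carrier_mat n m \<Longrightarrow> A *\<^sub>v 0\<^sub>v m = 0\<^sub>v n"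
  by (auto intro!: eq_vecI)

locale induced_representation = irreducible_subgroup_rep e n \<phi>
  for e :: "'s::{finite,inverse_semigroup}" and n :: nat and \<phi> :: "'s \<Rightarrow> 'k::field_char_0 mat" +
  fixes fs :: "'s list" and p :: "'s \<Rightarrow> 's"
  assumes distinct: "distinct fs" and set_fs: "set fs = isomorphic_idempotents e"
    and p: "\<And>f. f \<in> isomorphic_idempotents e \<Longrightarrow> sdom (p f) = e \<and> sran (p f) = f"
begin

abbreviation "star \<equiv> induced_rep n \<phi> fs p"
abbreviation "k \<equiv> length fs * n"

lemma p_simps:
  assumes "f \<in> set fs"
  shows "p f * sinv (p f) = e" "sinv (p f) * p f = f" "f \<in> idempotents"
    "p f * f = p f" "f * sinv (p f) = sinv (p f)" "e * p f = p f" "sinv (p f) * e = sinv (p f)"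
proof -
  show e: "p f * sinv (p f) = e" and f: "sinv (p f) * p f = f"
    using p[of f] assms set_fs by (auto simp: sdom_def sran_def)
  show "f \<in> idempotents" using sran_idempotent[of "p f"] unfolding f .
  have "p f * (sinv (p f) * p f) = p f" "sinv (p f) * p f * sinv (p f) = sinv (p f)"
    "p f * sinv (p f) * p f = p f" "sinv (p f) * (p f * sinv (p f)) = sinv (p f)"
    by simp_all
  then show "p f * f = p f" "f * sinv (p f) = sinv (p f)" "e * p f = p f" "sinv (p f) * e = sinv (p f)"
    unfolding e f by auto
qed

lemma e_in_fs: "e \<in> set fs"
  unfolding set_fs isomorphic_idempotents_def
  using e by (auto simp: sdom_def sran_def sinv_idempotent idempotentsD intro: exI[of _ e])

lemma in_fs_le_eq: "f \<in> set fs \<Longrightarrow> f \<le> e \<Longrightarrow> f = e"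
  using p[of f] isomorphic_idempotent_le_eq unfolding set_fs by blast

lemma star_carrier [simp]: "star s \<in> carrier_mat k k"
  by (simp add: induced_rep_def)

lemma star_index:
  assumes "a < length fs" "b < n" "a' < length fs" "b' < n"
  shows "star s $$ (a * n + b, a' * n + b') =
    (if fs ! a \<le> s * sinv s \<and> sinv s * fs ! a * s = fs ! a'
     then \<phi> (p (fs ! a) * s * sinv (p (fs ! a'))) $$ (b, b') else 0)"
  using assms block_index[OF assms(1,2)] block_index[OF assms(3,4)]
  by (simp add: induced_rep_def Let_def)

text \<open>
  A diagonal block of \<open>\<phi>\<^sup>*(h g)\<close> at \<open>f\<close> can be nonzero only if \<open>f \<le> h \<le> e\<close>. As \<open>f\<close> is
  isomorphic to \<open>e\<close>, this forces \<open>f = h = e\<close>, and the remaining block is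
  \<open>\<phi> g\<close> up to conjugation by \<open>p e\<close>.
\<close>

lemma trace_star:
  assumes h: "h \<le> e" and g: "g \<in> G"
  shows "mat_trace (star (h * g)) = (if h = e then mat_trace (\<phi> g) else 0)"
proof -
  note G = max_subgroupD[OF g] and hi = le_idempotent[OF e h]
  obtain a0 where a0: "a0 < length fs" "fs ! a0 = e" using e_in_fs by (auto simp: in_set_conv_nth)
  have dom: "h * g * sinv (h * g) = h"
  proof -
    have "h * g * sinv (h * g) = h * (g * sinv g) * h"
      by (simp add: sinv_mult sinv_idempotent hi mult.assoc)
    then show ?thesis using G hi by (simp add: idempotentsD)
  qed
  have pe: "p e \<in> G" using p_simps[OF e_in_fs] by (simp add: max_subgroup_iff)
  have diag: "star (h * g) $$ (a * n + b, a * n + b) =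
      (if a = a0 \<and> h = e then \<phi> (p e * g * sinv (p e)) $$ (b, b) else 0)"
    if ab: "a < length fs" "b < n" for a b
  proof (cases "fs ! a \<le> h")
    case True
    then have fe: "fs ! a = e" using in_fs_le_eq[of "fs ! a"] h ab by auto
    then have "h = e" using True h by simp
    moreover have "a = a0" using fe a0 nth_eq_iff_index_eq[OF distinct ab(1) a0(1)] by simp
    ultimately show ?thesis using ab G dom fe by (subst star_index) (auto simp: mult.assoc)
  next
    case False
    then have "\<not> (a = a0 \<and> h = e)" using a0 by auto
    then show ?thesis using False ab by (subst star_index) (auto simp: dom)
  qed
  have "mat_trace (star (h * g)) = (\<Sum>a<length fs. \<Sum>b<n. star (h * g) $$ (a * n + b, a * n + b))"
    using carrier_matD[OF star_carrier] by (simp add: mat_trace_def sum_blocks)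
  also have "\<dots> = (\<Sum>a<length fs. if a = a0 then (if h = e then \<Sum>b<n. \<phi> (p e * g * sinv (p e)) $$ (b, b) else 0) else 0)"
    by (intro sum.cong refl) (auto simp: diag)
  also have "\<dots> = (if h = e then mat_trace (\<phi> (p e * g * sinv (p e))) else 0)"
    using a0 carrier_matD[OF phi_carrier, of "p e * g * sinv (p e)"] pe g by (auto simp: mat_trace_def)
  finally show ?thesis using trace_phi_conjugate[OF g pe] by simp
qed

text \<open>
  The matrix of the map that sends a vector with blocks \<open>c\<^sub>f\<close> to the sum over \<open>f\<close> of
  \<open>\<sigma>(p\<^sub>f\<^sup>-\<^sup>1) X c\<^sub>f\<close>. It is the extension of a homomorphism \<open>X\<close> defined on \<open>\<phi>\<close>,
  viewed as the block of \<open>\<phi>\<^sup>*\<close> at \<open>e\<close>, to all of \<open>\<phi>\<^sup>*\<close>.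
\<close>

definition induced_map :: "nat \<Rightarrow> ('s \<Rightarrow> 'k mat) \<Rightarrow> 'k mat \<Rightarrow> 'k mat" where
  "induced_map N \<sigma> X =
     mat N k (\<lambda>(r, c). (\<sigma> (sinv (p (fs ! (c div n)))) * X) $$ (r, c mod n))"

lemma induced_map_carrier [simp]: "induced_map N \<sigma> X \<in> carrier_mat N k"
  by (simp add: induced_map_def)

end

text \<open>
  A homomorphism \<open>X\<close> of modules over the maximal subgroup, from \<open>\<phi>\<close> into a representation of
  the whole semigroup, whose image is annihilated by the idempotents strictly below \<open>e\<close>.
  This annihilation is what makes the extension of \<open>X\<close> to \<open>\<phi>\<^sup>*\<close> equivariant.
\<close>

locale subgroup_hom = induced_representation e n \<phi> fs p
  for e :: "'s::{finite,inverse_semigroup}" and n :: nat and \<phi> :: "'s \<Rightarrow> 'k::field_char_0 mat"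
    and fs :: "'s list" and p :: "'s \<Rightarrow> 's" +
  fixes N :: nat and \<sigma> :: "'s \<Rightarrow> 'k mat" and X :: "'k mat"
  assumes rep: "matrix_rep UNIV N \<sigma>" and X: "X \<in> carrier_mat N n"
    and hom: "\<And>g. g \<in> G \<Longrightarrow> \<sigma> g * X = X * \<phi> g"
    and below: "\<And>f. f < e \<Longrightarrow> \<sigma> f * X = 0\<^sub>m N n"
begin

abbreviation "Y \<equiv> induced_map N \<sigma> X"

lemma sigma_carrier [simp]: "\<sigma> s \<in> carrier_mat N N"
  and sigma_mult: "\<sigma> (s * t) = \<sigma> s * \<sigma> t"
  using rep by (auto simp: matrix_rep_def)

lemma sigma_mult_X: "\<sigma> (s * t) * X = \<sigma> s * (\<sigma> t * X)"
  unfolding sigma_mult by (rule assoc_mult_mat[OF sigma_carrier sigma_carrier X])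

lemma sigma_e_X: "\<sigma> e * X = X"
  using hom[OF one_in_G] X by (simp add: phi_one)

text \<open>
  As \<open>X\<close> is fixed by \<open>\<sigma> e\<close>, the element \<open>t\<close> may be replaced by
  \<open>t e = t (t\<^sup>-\<^sup>1 t e)\<close>, and \<open>t\<^sup>-\<^sup>1 t e\<close> is an idempotent strictly below \<open>e\<close>.
\<close>

lemma sigma_X_zero:
  assumes "\<not> e \<le> sinv t * t"
  shows "\<sigma> t * X = 0\<^sub>m N n"
proof -
  let ?f = "sinv t * t * e"
  have "?f \<le> e" "?f \<le> sinv t * t" using idempotent_mult_le[OF e sran_idempotent] by auto
  then have f: "?f < e" using assms by auto
  have "\<sigma> t * X = \<sigma> (t * e) * X" using sigma_e_X by (simp add: sigma_mult_X)
  also have "t * e = t * ?f" by (simp add: mult.assoc)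
  also have "\<sigma> (t * ?f) * X = \<sigma> t * (\<sigma> ?f * X)" by (rule sigma_mult_X)
  also have "\<dots> = 0\<^sub>m N n" unfolding below[OF f] by (rule right_mult_zero_mat[OF sigma_carrier])
  finally show ?thesis .
qed

lemma Y_index:
  assumes "a < length fs" "b < n" "r < N"
  shows "Y $$ (r, a * n + b) = (\<sigma> (sinv (p (fs ! a))) * X) $$ (r, b)"
  using assms block_index[OF assms(1,2)] by (simp add: induced_map_def)

lemma mult_Y_index:
  assumes M: "M \<in> carrier_mat N N" and ab: "a < length fs" "b < n" and r: "r < N"
  shows "(M * Y) $$ (r, a * n + b) = (M * (\<sigma> (sinv (p (fs ! a))) * X)) $$ (r, b)"
proof -
  let ?Z = "\<sigma> (sinv (p (fs ! a))) * X"
  have Z: "?Z \<in> carrier_mat N n" by (rule mult_carrier_mat[OF sigma_carrier X])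
  have "(M * Y) $$ (r, a * n + b) = (\<Sum>i<N. M $$ (r, i) * Y $$ (i, a * n + b))"
    using block_index(1)[OF ab] r carrier_matD[OF M] carrier_matD[OF induced_map_carrier[of N \<sigma> X]]
    by (simp add: scalar_prod_def lessThan_atLeast0)
  also have "\<dots> = (\<Sum>i<N. M $$ (r, i) * ?Z $$ (i, b))"
    by (intro sum.cong refl) (simp add: Y_index[OF ab])
  also have "\<dots> = (M * ?Z) $$ (r, b)"
    using ab r carrier_matD[OF M] carrier_matD[OF Z]
    by (simp add: scalar_prod_def lessThan_atLeast0 del: index_mult_mat(1)) (simp add: scalar_prod_def lessThan_atLeast0)
  finally show ?thesis .
qed

lemma sigma_Y_index:
  assumes "a < length fs" "b < n" "r < N"
  shows "(\<sigma> s * Y) $$ (r, a * n + b) = (\<sigma> (s * sinv (p (fs ! a))) * X) $$ (r, b)"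
  using mult_Y_index[OF sigma_carrier assms] by (simp only: sigma_mult_X)

lemma mult_Y_fixed:
  assumes M: "M \<in> carrier_mat N N" and fix_sigma: "\<And>s. M * \<sigma> s = \<sigma> s"
  shows "M * Y = Y"
proof (rule eq_matI)
  fix r c assume "r < dim_row Y" "c < dim_col Y"
  then have r: "r < N" and "c < k" by (simp_all only: carrier_matD[OF induced_map_carrier])
  then obtain a b where ab: "a < length fs" "b < n" "c = a * n + b" using block_index_cases by metis
  have "M * (\<sigma> s * X) = \<sigma> s * X" for s
    using assoc_mult_mat[OF M sigma_carrier X] fix_sigma by metis
  then show "(M * Y) $$ (r, c) = Y $$ (r, c)"
    unfolding ab(3) mult_Y_index[OF M ab(1,2) r] Y_index[OF ab(1,2) r] by simp
qed (use carrier_matD[OF M] in \<open>simp_all add: carrier_matD[OF induced_map_carrier]\<close>)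

text \<open>
  The kernel of a homomorphism is an invariant subspace of the irreducible \<open>\<phi>\<close>.
\<close>

lemma X_injective:
  assumes nz: "X \<noteq> 0\<^sub>m N n" and v: "v \<in> carrier_vec n" and z: "X *\<^sub>v v = 0\<^sub>v N"
  shows "v = 0\<^sub>v n"
proof -
  let ?K = "{v \<in> carrier_vec n. X *\<^sub>v v = 0\<^sub>v N}"
  have "?K = {0\<^sub>v n} \<or> ?K = carrier_vec n"
  proof (rule phi_irreducible[OF vec_subspace_kernel[OF X]])
    fix g w assume g: "g \<in> G" and w: "w \<in> ?K"
    have "X *\<^sub>v (\<phi> g *\<^sub>v w) = (X * \<phi> g) *\<^sub>v w"
      using w g X by (intro assoc_mult_mat_vec[symmetric, OF X phi_carrier]) auto
    also have "\<dots> = \<sigma> g *\<^sub>v (X *\<^sub>v w)"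
      unfolding hom[OF g, symmetric] using w by (intro assoc_mult_mat_vec[OF sigma_carrier X]) auto
    also have "\<dots> = 0\<^sub>v N" using w mult_mat_zero_vec[OF sigma_carrier] by simp
    finally show "\<phi> g *\<^sub>v w \<in> ?K" using w g mult_mat_vec_carrier[OF phi_carrier] by auto
  qed
  moreover have "?K \<noteq> carrier_vec n"
  proof
    assume K: "?K = carrier_vec n"
    have "X = 0\<^sub>m N n"
    proof (rule eq_mat_by_action[OF X zero_carrier_mat])
      fix v :: "'k vec" assume v: "v \<in> carrier_vec n"
      then have "X *\<^sub>v v = 0\<^sub>v N" using K by blast
      then show "X *\<^sub>v v = 0\<^sub>m N n *\<^sub>v v" using v by (auto intro!: eq_vecI)
    qed
    with nz show False ..
  qed
  ultimately show ?thesis using v z by blast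
qed

text \<open>
  Compare the columns belonging to \<open>f'\<close>, that is \<open>\<sigma>(s p\<^sub>f\<^sub>'\<^sup>-\<^sup>1) X\<close>. If \<open>f' \<le> s\<^sup>-\<^sup>1 s\<close>, the only
  nonzero block of \<open>\<phi>\<^sup>*(s)\<close> in these columns is in the row of \<open>f = s f' s\<^sup>-\<^sup>1\<close>, and
  \<open>s p\<^sub>f\<^sub>'\<^sup>-\<^sup>1 = p\<^sub>f\<^sup>-\<^sup>1 g\<close> with \<open>g = p\<^sub>f s p\<^sub>f\<^sub>'\<^sup>-\<^sup>1\<close> in the maximal subgroup. Otherwise there is no such block,
  and \<open>s p\<^sub>f\<^sub>'\<^sup>-\<^sup>1\<close> annihilates \<open>X\<close>.
\<close>

lemma Y_intertwines: "\<sigma> s * Y = Y * star s"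
proof (rule eq_matI)
  fix r c assume "r < dim_row (Y * star s)" "c < dim_col (Y * star s)"
  then have r: "r < N" and "c < k"
    using carrier_matD[OF induced_map_carrier[of N \<sigma> X]] carrier_matD[OF star_carrier[of s]] by auto
  then obtain a' b' where ab': "a' < length fs" "b' < n" "c = a' * n + b'" using block_index_cases by metis
  let ?f' = "fs ! a'"
  let ?q' = "sinv (p ?f')"
  have f': "?f' \<in> set fs" using ab' by simp
  note pf' = p_simps[OF f']
  define cond where "cond a \<longleftrightarrow> fs ! a \<le> s * sinv s \<and> sinv s * fs ! a * s = ?f'" for a
  let ?Z = "\<lambda>a. \<sigma> (sinv (p (fs ! a))) * X"
  have Z: "?Z a \<in> carrier_mat N n" for a by (rule mult_carrier_mat[OF sigma_carrier X])
  have inG: "p (fs ! a) * s * ?q' \<in> G" and repr: "s * ?q' = sinv (p (fs ! a)) * (p (fs ! a) * s * ?q')"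
    and eqf: "fs ! a = s * ?f' * sinv s"
    if a: "a < length fs" "cond a" for a
  proof -
    let ?f = "fs ! a"
    have "?f \<in> set fs" using a by simp
    note pf = p_simps[OF this]
    have c: "?f \<le> s * sinv s" "sinv s * ?f * s = ?f'" using a(2) by (auto simp: cond_def)
    have fd: "?f * (s * sinv s) = ?f" "(s * sinv s) * ?f = ?f"
      using le_idempotent[OF sdom_idempotent c(1)] by auto
    have "s * ?f' * sinv s = s * sinv s * ?f * (s * sinv s)" unfolding c(2)[symmetric] by (simp add: mult.assoc)
    then show eqf: "?f = s * ?f' * sinv s" using fd by simp
    have fs: "?f * s = s * ?f'" unfolding c(2)[symmetric] by (rule idempotent_slide[OF pf(3)])
    have "sinv (p ?f) * (p ?f * s * ?q') = (sinv (p ?f) * p ?f) * s * ?q'" by (simp add: mult.assoc)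
    also have "\<dots> = s * (?f' * ?q')" by (simp add: pf(2) fs mult.assoc)
    finally show "s * ?q' = sinv (p ?f) * (p ?f * s * ?q')" by (simp add: pf')
    have "p ?f * s * ?q' * sinv (p ?f * s * ?q') = p ?f * (s * (?q' * p ?f') * sinv s) * sinv (p ?f)"
      by (simp add: sinv_mult mult.assoc)
    also have "\<dots> = p ?f * ?f * sinv (p ?f)" unfolding pf'(2) eqf[symmetric] ..
    also have "\<dots> = e" using pf by simp
    finally have 1: "p ?f * s * ?q' * sinv (p ?f * s * ?q') = e" .
    have "sinv (p ?f * s * ?q') * (p ?f * s * ?q') = p ?f' * (sinv s * (sinv (p ?f) * p ?f) * s) * ?q'"
      by (simp add: sinv_mult mult.assoc)
    also have "\<dots> = e" unfolding pf(2) c(2) using pf' by simp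
    finally show "p ?f * s * ?q' \<in> G" using 1 by (simp add: max_subgroup_iff)
  qed
  have block: "(\<Sum>b<n. Y $$ (r, a * n + b) * star s $$ (a * n + b, c)) =
      (if cond a then (\<sigma> (s * ?q') * X) $$ (r, b') else 0)" if a: "a < length fs" for a
  proof (cases "cond a")
    case True
    let ?g = "p (fs ! a) * s * ?q'"
    note G = inG[OF a True]
    have "(\<Sum>b<n. Y $$ (r, a * n + b) * star s $$ (a * n + b, c)) = (\<Sum>b<n. ?Z a $$ (r, b) * \<phi> ?g $$ (b, b'))"
      using True by (intro sum.cong refl) (auto simp: Y_index[OF a _ r] star_index[OF a _ ab'(1,2)] ab'(3) cond_def)
    also have "\<dots> = (?Z a * \<phi> ?g) $$ (r, b')"
      using r ab' carrier_matD[OF Z] carrier_matD[OF phi_carrier[OF G]]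
      by (simp add: scalar_prod_def lessThan_atLeast0 del: index_mult_mat(1)) (simp add: scalar_prod_def lessThan_atLeast0)
    also have "?Z a * \<phi> ?g = \<sigma> (sinv (p (fs ! a))) * (X * \<phi> ?g)"
      by (rule assoc_mult_mat[OF sigma_carrier X phi_carrier[OF G]])
    also have "\<dots> = \<sigma> (s * ?q') * X"
      unfolding hom[OF G, symmetric] sigma_mult_X[symmetric] using repr[OF a True] by simp
    finally show ?thesis using True by simp
  next
    case False
    then show ?thesis
      by (auto simp: star_index[OF a _ ab'(1,2)] ab'(3) cond_def intro!: sum.neutral)
  qed
  have "(Y * star s) $$ (r, c) = (\<Sum>i<k. Y $$ (r, i) * star s $$ (i, c))"
    using r \<open>c < k\<close> carrier_matD[OF induced_map_carrier[of N \<sigma> X]] carrier_matD[OF star_carrier[of s]]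
    by (simp add: scalar_prod_def lessThan_atLeast0)
  also have "\<dots> = (\<Sum>a<length fs. if cond a then (\<sigma> (s * ?q') * X) $$ (r, b') else 0)"
    unfolding sum_blocks by (intro sum.cong refl) (simp add: block)
  also have "\<dots> = (\<sigma> (s * ?q') * X) $$ (r, b')"
  proof (cases "?f' \<le> sinv s * s")
    case True
    note le = le_idempotent[OF sran_idempotent True]
    let ?f = "s * ?f' * sinv s"
    have f: "?f = sinv (sinv s) * ?f' * sinv s" by simp
    have fi: "?f \<in> idempotents" unfolding f by (rule conjugate_idempotent[OF pf'(3)])
    have "sdom (p ?f' * sinv s) = e"
    proof -
      have "p ?f' * sinv s * sinv (p ?f' * sinv s) = p ?f' * (sinv s * s) * ?q'"
        by (simp add: sinv_mult mult.assoc)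
      also have "\<dots> = p ?f' * (?f' * (sinv s * s)) * ?q'"
        using pf'(4) by (simp flip: mult.assoc)
      also have "\<dots> = e" unfolding le(2) using pf' by simp
      finally show ?thesis by (simp add: sdom_def)
    qed
    moreover have "sran (p ?f' * sinv s) = ?f"
    proof -
      have "sinv (p ?f' * sinv s) * (p ?f' * sinv s) = s * (?q' * p ?f') * sinv s"
        by (simp add: sinv_mult mult.assoc)
      then show ?thesis by (simp add: sran_def pf')
    qed
    ultimately have "?f \<in> set fs" unfolding set_fs isomorphic_idempotents_def using fi by blast
    then obtain a0 where a0: "a0 < length fs" "fs ! a0 = ?f" by (auto simp: in_set_conv_nth)
    have "?f \<le> s * sinv s" using conjugate_le[OF pf'(3), of "sinv s"] by simp
    moreover have "sinv s * ?f * s = sinv s * s * ?f' * (sinv s * s)" by (simp add: mult.assoc)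
    ultimately have "cond a0" using le by (simp add: cond_def a0)
    then have "cond a \<longleftrightarrow> a = a0" if "a < length fs" for a
      using eqf[OF that] a0 distinct that by (metis nth_eq_iff_index_eq)
    then have "(\<Sum>a<length fs. if cond a then (\<sigma> (s * ?q') * X) $$ (r, b') else 0) =
      (\<Sum>a<length fs. if a = a0 then (\<sigma> (s * ?q') * X) $$ (r, b') else 0)"
      by (intro sum.cong refl) auto
    then show ?thesis using a0 by simp
  next
    case False
    have "\<not> cond a" if "a < length fs" for a
      using False conjugate_le[of "fs ! a" s] p_simps(3)[of "fs ! a"] that by (auto simp: cond_def)
    moreover have "\<not> e \<le> sinv (s * ?q') * (s * ?q')"
    proof
      assume le: "e \<le> sinv (s * ?q') * (s * ?q')"
      have eq: "sinv (s * ?q') * (s * ?q') = p ?f' * (sinv s * s) * ?q'" by (simp add: sinv_mult mult.assoc)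
      have "e = e * (p ?f' * (sinv s * s) * ?q')"
        using le_idempotent(2)[OF sran_idempotent le] unfolding eq by simp
      also have "\<dots> = (e * p ?f') * (sinv s * s) * ?q'" by (simp add: mult.assoc)
      also have "\<dots> = p ?f' * (sinv s * s) * ?q'" by (simp add: pf')
      finally have e': "e = p ?f' * (sinv s * s) * ?q'" .
      have "?f' = ?q' * e * p ?f'" using pf' by simp
      also have "\<dots> = (?q' * p ?f') * (sinv s * s) * (?q' * p ?f')" by (subst e') (simp add: mult.assoc)
      also have "\<dots> = ?f' * ?f' * (sinv s * s)"
        unfolding pf'(2) using idempotents_commute[OF pf'(3) sran_idempotent[of s]] by (metis mult.assoc)
      also have "\<dots> = ?f' * (sinv s * s)" using pf'(3) by (simp add: idempotentsD)
      finally show False using False idempotent_le_iff[OF sran_idempotent pf'(3)] by metis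
    qed
    then have "\<sigma> (s * ?q') * X = 0\<^sub>m N n" by (rule sigma_X_zero)
    ultimately show ?thesis using r ab' by simp
  qed
  also have "\<dots> = (\<sigma> s * Y) $$ (r, c)" using sigma_Y_index[OF ab'(1,2) r] ab'(3) by simp
  finally show "(\<sigma> s * Y) $$ (r, c) = (Y * star s) $$ (r, c)" ..
qed (use carrier_matD[OF sigma_carrier[of s]] carrier_matD[OF induced_map_carrier[of N \<sigma> X]] carrier_matD[OF star_carrier[of s]] in auto)

text \<open>
  Applying \<open>\<sigma>(p\<^sub>f)\<close> to the image of a vector isolates \<open>X\<close> applied to its block at \<open>f\<close>: for
  \<open>f' \<noteq> f\<close> the element \<open>p\<^sub>f p\<^sub>f\<^sub>'\<^sup>-\<^sup>1\<close> annihilates \<open>X\<close>, since otherwise \<open>f' \<le> f\<close>, which is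
  impossible for distinct isomorphic idempotents.
\<close>

lemma Y_injective:
  assumes nz: "X \<noteq> 0\<^sub>m N n" and v: "v \<in> carrier_vec k" and z: "Y *\<^sub>v v = 0\<^sub>v N"
  shows "v = 0\<^sub>v k"
proof -
  have comp: "vec n (\<lambda>b. v $ (a0 * n + b)) = 0\<^sub>v n" if a0: "a0 < length fs" for a0
  proof (rule X_injective[OF nz])
    let ?f = "fs ! a0" and ?w = "vec n (\<lambda>b. v $ (a0 * n + b))"
    have f: "?f \<in> set fs" using a0 by simp
    note pf = p_simps[OF f]
    have act: "\<sigma> (p ?f * sinv (p (fs ! a))) * X = (if a = a0 then X else 0\<^sub>m N n)" if a: "a < length fs" for a
    proof (cases "a = a0")
      case True then show ?thesis using pf sigma_e_X by simp
    next
      case False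
      let ?f' = "fs ! a"
      have f': "?f' \<in> set fs" using a by simp
      note pf' = p_simps[OF f']
      let ?t = "p ?f * sinv (p ?f')"
      have "\<not> e \<le> sinv ?t * ?t"
      proof
        assume le: "e \<le> sinv ?t * ?t"
        have eq: "sinv ?t * ?t = p ?f' * ?f * sinv (p ?f')"
        proof -
          have "sinv ?t * ?t = p ?f' * (sinv (p ?f) * p ?f) * sinv (p ?f')" by (simp add: sinv_mult mult.assoc)
          then show ?thesis unfolding pf(2) .
        qed
        have "e = e * (p ?f' * ?f * sinv (p ?f'))"
          using le_idempotent(2)[OF sran_idempotent le] unfolding eq by simp
        also have "\<dots> = (e * p ?f') * ?f * sinv (p ?f')" by (simp add: mult.assoc)
        also have "\<dots> = p ?f' * ?f * sinv (p ?f')" by (simp add: pf')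
        finally have e': "e = p ?f' * ?f * sinv (p ?f')" .
        have "?f' = sinv (p ?f') * e * p ?f'" using pf' by simp
        also have "\<dots> = (sinv (p ?f') * p ?f') * ?f * (sinv (p ?f') * p ?f')" by (subst e') (simp add: mult.assoc)
        also have "\<dots> = ?f' * ?f' * ?f"
          unfolding pf'(2) by (simp only: mult.assoc idempotents_commute[OF pf(3) pf'(3)])
        also have "\<dots> = ?f' * ?f" using pf'(3) by (simp add: idempotentsD)
        finally have "?f' * ?f = ?f'" by simp
        then have "?f' \<le> ?f" using idempotent_le_iff[OF pf(3) pf'(3)] by simp
        moreover have "sdom (sinv (p ?f) * p ?f') = ?f" "sran (sinv (p ?f) * p ?f') = ?f'"
        proof -
          have "sinv (p ?f) * p ?f' * sinv (sinv (p ?f) * p ?f') = sinv (p ?f) * (p ?f' * sinv (p ?f')) * p ?f"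
            by (simp add: sinv_mult mult.assoc)
          then show "sdom (sinv (p ?f) * p ?f') = ?f" using pf pf' by (simp add: sdom_def)
          have "sinv (sinv (p ?f) * p ?f') * (sinv (p ?f) * p ?f') = sinv (p ?f') * (p ?f * sinv (p ?f)) * p ?f'"
            by (simp add: sinv_mult mult.assoc)
          then show "sran (sinv (p ?f) * p ?f') = ?f'" using pf pf' by (simp add: sran_def)
        qed
        ultimately have "?f' = ?f" using isomorphic_idempotent_le_eq by blast
        then show False using False a a0 distinct by (simp add: nth_eq_iff_index_eq)
      qed
      then show ?thesis using sigma_X_zero False by simp
    qed
    show "X *\<^sub>v ?w = 0\<^sub>v N"
    proof (rule eq_vecI)
      fix r assume "r < dim_vec (0\<^sub>v N :: 'k vec)"
      then have r: "r < N" by simp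
      have SY: "\<sigma> (p ?f) * Y \<in> carrier_mat N k" by (rule mult_carrier_mat[OF sigma_carrier induced_map_carrier])
      have "(\<sigma> (p ?f) * Y) *\<^sub>v v = \<sigma> (p ?f) *\<^sub>v (Y *\<^sub>v v)"
        by (rule assoc_mult_mat_vec[OF sigma_carrier induced_map_carrier v])
      also have "\<dots> = 0\<^sub>v N" using z mult_mat_zero_vec[OF sigma_carrier] by simp
      finally have "0 = ((\<sigma> (p ?f) * Y) *\<^sub>v v) $ r" using r by simp
      also have "\<dots> = (\<Sum>i<k. (\<sigma> (p ?f) * Y) $$ (r, i) * v $ i)"
        using r v carrier_matD[OF SY] by (simp add: scalar_prod_def lessThan_atLeast0 del: index_mult_mat(1))
      also have "\<dots> = (\<Sum>a<length fs. \<Sum>b<n. (\<sigma> (p ?f * sinv (p (fs ! a))) * X) $$ (r, b) * v $ (a * n + b))"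
        unfolding sum_blocks by (intro sum.cong refl) (simp add: sigma_Y_index[OF _ _ r] del: index_mult_mat(1))
      also have "\<dots> = (\<Sum>a<length fs. if a = a0 then (\<Sum>b<n. X $$ (r, b) * v $ (a0 * n + b)) else 0)"
        by (intro sum.cong refl) (auto simp: act r simp del: index_mult_mat(1))
      also have "\<dots> = (\<Sum>b<n. X $$ (r, b) * v $ (a0 * n + b))" using a0 by simp
      also have "\<dots> = (X *\<^sub>v ?w) $ r" using X r by (simp add: scalar_prod_def lessThan_atLeast0)
      finally show "(X *\<^sub>v ?w) $ r = 0\<^sub>v N $ r" using r by simp
    qed (use X in simp)
  qed simp
  show ?thesis
  proof (rule eq_vecI)
    fix c assume "c < dim_vec (0\<^sub>v k :: 'k vec)"
    then have "c < k" by simp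
    then obtain a b where ab: "a < length fs" "b < n" "c = a * n + b" using block_index_cases by metis
    have "vec n (\<lambda>b. v $ (a * n + b)) $ b = 0\<^sub>v n $ b" using comp[OF ab(1)] by simp
    then show "v $ c = 0\<^sub>v k $ c" using ab \<open>c < k\<close> by simp
  qed (use v in simp)
qed

end

section \<open>Subquotients\<close>

lemma vec_diff_cancel:
  fixes v w :: "'a::ab_group_add vec"
  assumes "v \<in> carrier_vec n" "w \<in> carrier_vec n"
  shows "v - (v - w) = w" "v - w + w = v" "v - v = 0\<^sub>v n"
  using assms by (auto intro!: eq_vecI)

text \<open>
  Invariant subspaces \<open>U \<subseteq> W\<close> with chosen projections \<open>pU\<close> and \<open>pW\<close> onto them. The two
  projections may be unrelated.
\<close>

locale subquotient =
  fixes N :: nat and \<rho> :: "'s::semigroup_mult \<Rightarrow> 'k::field mat" and U W :: "'k vec set"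
    and pU pW :: "'k mat"
  assumes rep: "matrix_rep UNIV N \<rho>"
    and U: "invariant_subspace UNIV N \<rho> U" and W: "invariant_subspace UNIV N \<rho> W"
    and UW: "U \<subseteq> W"
    and pU_carrier: "pU \<in> carrier_mat N N" and pW_carrier: "pW \<in> carrier_mat N N"
    and pU_range: "\<And>v. v \<in> carrier_vec N \<Longrightarrow> pU *\<^sub>v v \<in> U"
    and pW_range: "\<And>v. v \<in> carrier_vec N \<Longrightarrow> pW *\<^sub>v v \<in> W"
    and pU_id: "\<And>v. v \<in> U \<Longrightarrow> pU *\<^sub>v v = v" and pW_id: "\<And>v. v \<in> W \<Longrightarrow> pW *\<^sub>v v = v"
begin

text \<open>
  \<open>Q\<close> is a projection onto a complement of \<open>U\<close> in \<open>W\<close>, so the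
  compression \<open>\<sigma>\<close> realises the module \<open>W / U\<close> by matrices of the original size.
\<close>

definition Q :: "'k mat" where "Q = pW - pU * pW"

definition \<sigma> :: "'s \<Rightarrow> 'k mat" where "\<sigma> s = Q * \<rho> s * Q"

lemma subspaces: "vec_subspace N U" "vec_subspace N W"
  using U W by (auto simp: invariant_subspace_iff)

lemma in_carrier: "u \<in> U \<Longrightarrow> u \<in> carrier_vec N" "w \<in> W \<Longrightarrow> w \<in> carrier_vec N"
  using vec_subspaceD(1) subspaces by blast+

lemma rho_carrier [simp]: "\<rho> s \<in> carrier_mat N N" and rho_mult: "\<rho> (s * t) = \<rho> s * \<rho> t"
  using rep by (auto simp: matrix_rep_def)

lemma rho_invariant: "u \<in> U \<Longrightarrow> \<rho> s *\<^sub>v u \<in> U" "w \<in> W \<Longrightarrow> \<rho> s *\<^sub>v w \<in> W"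
  using U W by (auto simp: invariant_subspace_iff)

lemma Q_carrier [simp]: "Q \<in> carrier_mat N N"
  unfolding Q_def by (intro minus_carrier_mat mult_carrier_mat[OF pU_carrier pW_carrier])

lemma sigma_carrier [simp]: "\<sigma> s \<in> carrier_mat N N"
  unfolding \<sigma>_def by (intro mult_carrier_mat[OF mult_carrier_mat[OF Q_carrier rho_carrier] Q_carrier])

lemma Q_apply:
  assumes v: "v \<in> carrier_vec N" shows "Q *\<^sub>v v = pW *\<^sub>v v - pU *\<^sub>v (pW *\<^sub>v v)"
  unfolding Q_def
  using minus_mult_distrib_mat_vec[OF pW_carrier mult_carrier_mat[OF pU_carrier pW_carrier] v]
    assoc_mult_mat_vec[OF pU_carrier pW_carrier v] by simp

lemma Q_on_W: "w \<in> W \<Longrightarrow> Q *\<^sub>v w = w - pU *\<^sub>v w"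
  using Q_apply[OF in_carrier(2)] pW_id by simp

lemma Q_range: "v \<in> carrier_vec N \<Longrightarrow> Q *\<^sub>v v \<in> W"
  using Q_apply vec_subspaceD(5)[OF subspaces(2)] pW_range pU_range[OF in_carrier(2)] UW by (metis subsetD)

lemma Q_mod_U:
  assumes "w \<in> W" shows "w - Q *\<^sub>v w \<in> U"
proof -
  have "w - Q *\<^sub>v w = pU *\<^sub>v w"
    using Q_on_W[OF assms] in_carrier(2)[OF assms] in_carrier(1)[OF pU_range[OF in_carrier(2)[OF assms]]]
    by (simp add: vec_diff_cancel)
  then show ?thesis using pU_range[OF in_carrier(2)[OF assms]] by simp
qed

lemma Q_on_U: "u \<in> U \<Longrightarrow> Q *\<^sub>v u = 0\<^sub>v N"
  using Q_on_W[of u] UW pU_id[of u] vec_diff_cancel(3)[OF in_carrier(1) in_carrier(1)] by auto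

lemma Q_kernel:
  assumes "w \<in> W" "Q *\<^sub>v w = 0\<^sub>v N" shows "w \<in> U"
  using Q_mod_U[OF assms(1)] in_carrier(2)[OF assms(1)] assms(2) by simp

lemma Q_congruent:
  assumes "v \<in> W" "w \<in> W" "v - w \<in> U" shows "Q *\<^sub>v v = Q *\<^sub>v w"
proof -
  note c = in_carrier(2)[OF assms(1)] in_carrier(2)[OF assms(2)]
  have "Q *\<^sub>v v = Q *\<^sub>v ((v - w) + w)" using vec_diff_cancel(2)[OF c] by simp
  also have "\<dots> = Q *\<^sub>v (v - w) + Q *\<^sub>v w"
    using c by (intro mult_add_distrib_mat_vec[OF Q_carrier]) auto
  also have "\<dots> = Q *\<^sub>v w" using Q_on_U[OF assms(3)] mult_mat_vec_carrier[OF Q_carrier c(2)] by simp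
  finally show ?thesis .
qed

lemma Q_idem: "v \<in> W \<Longrightarrow> Q *\<^sub>v (Q *\<^sub>v v) = Q *\<^sub>v v"
  using Q_congruent[of v "Q *\<^sub>v v"] Q_mod_U Q_range in_carrier(2) by metis

lemma Q_idem': "v \<in> carrier_vec N \<Longrightarrow> Q *\<^sub>v (Q *\<^sub>v v) = Q *\<^sub>v v"
proof -
  assume v: "v \<in> carrier_vec N"
  have "Q *\<^sub>v v = Q *\<^sub>v (pW *\<^sub>v v)"
    using Q_apply[OF v] Q_on_W[OF pW_range[OF v]] by simp
  then show ?thesis using Q_idem[OF pW_range[OF v]] by simp
qed

lemma sigma_apply: "v \<in> carrier_vec N \<Longrightarrow> \<sigma> s *\<^sub>v v = Q *\<^sub>v (\<rho> s *\<^sub>v (Q *\<^sub>v v))"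
  unfolding \<sigma>_def
  using assoc_mult_mat_vec[OF mult_carrier_mat[OF Q_carrier rho_carrier] Q_carrier, of v s]
    assoc_mult_mat_vec[OF Q_carrier rho_carrier mult_mat_vec_carrier[OF Q_carrier], of v s] by simp

lemma Q_rho:
  assumes w: "w \<in> W" shows "Q *\<^sub>v (\<rho> s *\<^sub>v (Q *\<^sub>v w)) = Q *\<^sub>v (\<rho> s *\<^sub>v w)"
proof (rule Q_congruent[symmetric])
  note c = in_carrier(2)[OF w]
  have "\<rho> s *\<^sub>v w - \<rho> s *\<^sub>v (Q *\<^sub>v w) = \<rho> s *\<^sub>v (w - Q *\<^sub>v w)"
    using mult_minus_distrib_mat_vec[OF rho_carrier c mult_mat_vec_carrier[OF Q_carrier c]] by simp
  then show "\<rho> s *\<^sub>v w - \<rho> s *\<^sub>v (Q *\<^sub>v w) \<in> U" using rho_invariant(1)[OF Q_mod_U[OF w]] by simp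
qed (use w rho_invariant(2) Q_range[OF in_carrier(2)[OF w]] in auto)

lemma sigma_on_W: "w \<in> W \<Longrightarrow> \<sigma> s *\<^sub>v w = Q *\<^sub>v (\<rho> s *\<^sub>v w)"
  using sigma_apply[OF in_carrier(2)] Q_rho by simp

lemma rep_sigma: "matrix_rep UNIV N \<sigma>"
  unfolding matrix_rep_def
proof (intro conjI ballI)
  fix s t
  show "\<sigma> (s * t) = \<sigma> s * \<sigma> t"
  proof (rule eq_mat_by_action)
    fix v :: "'k vec" assume v: "v \<in> carrier_vec N"
    let ?w = "Q *\<^sub>v v"
    have w: "?w \<in> W" by (rule Q_range[OF v])
    have "(\<sigma> s * \<sigma> t) *\<^sub>v v = \<sigma> s *\<^sub>v (\<sigma> t *\<^sub>v v)"
      by (rule assoc_mult_mat_vec[OF sigma_carrier sigma_carrier v])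
    also have "\<dots> = \<sigma> s *\<^sub>v (Q *\<^sub>v (\<rho> t *\<^sub>v ?w))" using sigma_apply[OF v] by simp
    also have "\<dots> = Q *\<^sub>v (\<rho> s *\<^sub>v (Q *\<^sub>v (\<rho> t *\<^sub>v ?w)))"
      by (rule sigma_on_W[OF Q_range[OF in_carrier(2)[OF rho_invariant(2)[OF w]]]])
    also have "\<dots> = Q *\<^sub>v (\<rho> s *\<^sub>v (\<rho> t *\<^sub>v ?w))" by (rule Q_rho[OF rho_invariant(2)[OF w]])
    also have "\<dots> = Q *\<^sub>v (\<rho> (s * t) *\<^sub>v ?w)"
      unfolding rho_mult using assoc_mult_mat_vec[OF rho_carrier rho_carrier in_carrier(2)[OF w], of s t] by simp
    also have "\<dots> = \<sigma> (s * t) *\<^sub>v v" using sigma_apply[OF v] by simp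
    finally show "\<sigma> (s * t) *\<^sub>v v = (\<sigma> s * \<sigma> t) *\<^sub>v v" by simp
  qed (auto intro: mult_carrier_mat[OF sigma_carrier sigma_carrier])
qed simp

lemma Q_Q: "Q * Q = Q"
  by (rule eq_mat_by_action[of _ N N]) (auto simp: assoc_mult_mat_vec[OF Q_carrier Q_carrier] Q_idem'
      intro: mult_carrier_mat[OF Q_carrier Q_carrier])

lemma Q_sigma: "Q * \<sigma> s = \<sigma> s"
proof -
  have "Q * \<sigma> s = Q * Q * (\<rho> s * Q)"
    unfolding \<sigma>_def
    by (simp add: assoc_mult_mat[OF Q_carrier Q_carrier] assoc_mult_mat[OF Q_carrier rho_carrier Q_carrier]
        mult_carrier_mat[OF rho_carrier Q_carrier] assoc_mult_mat[OF Q_carrier Q_carrier mult_carrier_mat[OF rho_carrier Q_carrier]])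
  then show ?thesis unfolding Q_Q \<sigma>_def by (simp add: assoc_mult_mat[OF Q_carrier rho_carrier Q_carrier])
qed

text \<open>
  The trace on \<open>W / U\<close> is the trace on \<open>W\<close> minus the trace on \<open>U\<close>. The mixed term is computed by
  \<open>pW \<rho>(s) pU = \<rho>(s) pU\<close>, valid because \<open>U\<close> is invariant and contained in \<open>W\<close>.
\<close>

lemma trace_sigma: "mat_trace (\<sigma> s) = mat_trace (\<rho> s * pW) - mat_trace (\<rho> s * pU)"
proof -
  have rQ: "\<rho> s * Q \<in> carrier_mat N N" and QR: "Q * \<rho> s \<in> carrier_mat N N"
    and UWc: "pU * pW \<in> carrier_mat N N"
    by (auto intro!: mult_carrier_mat[of _ N N] pU_carrier pW_carrier)
  have "mat_trace (\<sigma> s) = mat_trace (Q * (\<rho> s * Q))"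
    unfolding \<sigma>_def by (simp add: assoc_mult_mat[OF Q_carrier rho_carrier Q_carrier])
  also have "\<dots> = mat_trace (\<rho> s * Q * Q)" by (rule mat_trace_comm[OF Q_carrier rQ])
  also have "\<rho> s * Q * Q = \<rho> s * Q"
    by (simp add: assoc_mult_mat[OF rho_carrier Q_carrier Q_carrier] Q_Q)
  also have "\<rho> s * Q = \<rho> s * pW - \<rho> s * (pU * pW)"
    unfolding Q_def by (rule mult_minus_distrib_mat[OF rho_carrier pW_carrier UWc])
  also have "mat_trace \<dots> = mat_trace (\<rho> s * pW) - mat_trace (\<rho> s * (pU * pW))"
    using carrier_matD[OF rho_carrier[of s]] carrier_matD[OF pU_carrier] carrier_matD[OF pW_carrier]
    by (simp add: mat_trace_def sum_subtractf del: index_mult_mat(1))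
  also have "\<rho> s * (pU * pW) = (\<rho> s * pU) * pW"
    by (simp add: assoc_mult_mat[OF rho_carrier pU_carrier pW_carrier])
  also have "mat_trace \<dots> = mat_trace (pW * (\<rho> s * pU))"
    by (rule mat_trace_comm[OF mult_carrier_mat[OF rho_carrier pU_carrier] pW_carrier])
  also have "pW * (\<rho> s * pU) = \<rho> s * pU"
  proof (rule eq_mat_by_action)
    fix v :: "'k vec" assume v: "v \<in> carrier_vec N"
    have "(\<rho> s * pU) *\<^sub>v v = \<rho> s *\<^sub>v (pU *\<^sub>v v)" by (rule assoc_mult_mat_vec[OF rho_carrier pU_carrier v])
    also have "\<dots> \<in> W" using rho_invariant(1)[OF pU_range[OF v]] UW by auto
    finally show "(pW * (\<rho> s * pU)) *\<^sub>v v = (\<rho> s * pU) *\<^sub>v v"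
      using assoc_mult_mat_vec[OF pW_carrier mult_carrier_mat[OF rho_carrier pU_carrier] v] pW_id by simp
  qed (auto intro!: mult_carrier_mat[of _ N N] pU_carrier pW_carrier)
  finally show ?thesis .
qed

text \<open>
  The image of \<open>Q\<close>, on which \<open>\<sigma>\<close> is a copy of the module \<open>W / U\<close>.
\<close>

definition Qspace :: "'k vec set" where "Qspace = {w \<in> W. Q *\<^sub>v w = w}"

lemma Qspace_subspace: "vec_subspace N Qspace"
  unfolding vec_subspace_def Qspace_def
  using vec_subspaceD[OF subspaces(2)] in_carrier(2)
  by (auto simp: mult_mat_zero_vec[OF Q_carrier] mult_add_distrib_mat_vec[OF Q_carrier] mult_mat_vec[OF Q_carrier])

text \<open>
  If there is no invariant subspace strictly between \<open>U\<close> and \<open>W\<close>, then \<open>\<sigma>\<close> is irreducible on the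
  image of \<open>Q\<close>: the preimage of \<open>Z\<close> under \<open>Q\<close> in \<open>W\<close> is invariant for \<open>\<rho>\<close>.
\<close>

lemma simple_sigma:
  assumes simple: "\<And>V. invariant_subspace UNIV N \<rho> V \<Longrightarrow> U \<subseteq> V \<Longrightarrow> V \<subseteq> W \<Longrightarrow> V = U \<or> V = W"
    and Z: "vec_subspace N Z" "Z \<subseteq> Qspace" "\<And>s z. z \<in> Z \<Longrightarrow> \<sigma> s *\<^sub>v z \<in> Z" "Z \<noteq> {0\<^sub>v N}"
    and w: "w \<in> W"
  shows "Q *\<^sub>v w \<in> Z"
proof -
  note Zs = vec_subspaceD[OF Z(1)] and Ws = vec_subspaceD[OF subspaces(2)]
  let ?V = "{w \<in> W. Q *\<^sub>v w \<in> Z}"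
  have "invariant_subspace UNIV N \<rho> ?V"
    unfolding invariant_subspace_iff
  proof (intro conjI ballI)
    show "vec_subspace N ?V"
      unfolding vec_subspace_def using Zs Ws in_carrier(2)
      by (auto simp: mult_mat_zero_vec[OF Q_carrier] mult_add_distrib_mat_vec[OF Q_carrier] mult_mat_vec[OF Q_carrier])
    fix s v assume v: "v \<in> ?V"
    have "Q *\<^sub>v (\<rho> s *\<^sub>v v) = \<sigma> s *\<^sub>v (Q *\<^sub>v v)"
      using v sigma_on_W[OF Q_range[OF in_carrier(2)]] Q_rho by simp
    then show "\<rho> s *\<^sub>v v \<in> ?V" using v rho_invariant(2) Z(3) by simp
  qed
  moreover have "U \<subseteq> ?V" using UW Q_on_U Zs(2) by auto
  moreover have "?V \<noteq> U"
  proof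
    assume VU: "?V = U"
    obtain z where z: "z \<in> Z" "z \<noteq> 0\<^sub>v N" using Z(4) Zs(2) by blast
    then have "z \<in> ?V" using Z(2) by (auto simp: Qspace_def)
    then have "Q *\<^sub>v z = 0\<^sub>v N" using VU Q_on_U by auto
    then show False using z Z(2) by (auto simp: Qspace_def)
  qed
  ultimately have "?V = W" using simple[of ?V] by blast
  then show ?thesis using w by auto
qed

text \<open>
  With \<open>L\<close> a left inverse of the isomorphism \<open>Y\<close>, the matrix \<open>L Q\<close> is the required equivariant
  surjection from \<open>W\<close> with kernel \<open>U\<close>.
\<close>

lemma factor_equivalentI:
  assumes Y: "Y \<in> carrier_mat N k" and inter: "\<And>s. \<sigma> s * Y = Y * \<tau> s" and tau: "\<And>s. \<tau> s \<in> carrier_mat k k"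
    and inj: "\<And>v. v \<in> carrier_vec k \<Longrightarrow> Y *\<^sub>v v = 0\<^sub>v N \<Longrightarrow> v = 0\<^sub>v k"
    and surj: "(\<lambda>v. Y *\<^sub>v v) ` carrier_vec k = Qspace"
  shows "factor_equivalent UNIV N \<rho> U W k \<tau>"
proof -
  have "vec_subspace k (carrier_vec k :: 'k vec set)" by (auto simp: vec_subspace_def)
  from left_inverse_on_subspace[OF this Y inj] obtain L where L: "L \<in> carrier_mat k N"
    "\<And>v. v \<in> carrier_vec k \<Longrightarrow> L *\<^sub>v (Y *\<^sub>v v) = v" by metis
  let ?T = "L * Q"
  have T: "?T \<in> carrier_mat k N" by (rule mult_carrier_mat[OF L(1) Q_carrier])
  have Tv: "?T *\<^sub>v v = L *\<^sub>v (Q *\<^sub>v v)" if "v \<in> carrier_vec N" for v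
    by (rule assoc_mult_mat_vec[OF L(1) Q_carrier that])
  have key: "Q *\<^sub>v w = Y *\<^sub>v (?T *\<^sub>v w)" "?T *\<^sub>v w \<in> carrier_vec k" if w: "w \<in> W" for w
  proof -
    have "Q *\<^sub>v w \<in> Qspace" using Q_idem[OF w] Q_range[OF in_carrier(2)[OF w]] by (simp add: Qspace_def)
    then obtain c where c: "c \<in> carrier_vec k" "Q *\<^sub>v w = Y *\<^sub>v c" using surj by auto
    then have "?T *\<^sub>v w = c" using Tv[OF in_carrier(2)[OF w]] L(2) by simp
    with c show "Q *\<^sub>v w = Y *\<^sub>v (?T *\<^sub>v w)" "?T *\<^sub>v w \<in> carrier_vec k" by simp_all
  qed
  show ?thesis unfolding factor_equivalent_def
  proof (intro bexI[OF _ T] conjI ballI)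
    show "(\<lambda>w. ?T *\<^sub>v w) ` W = carrier_vec k"
    proof (intro equalityI subsetI)
      fix c :: "'k vec" assume c: "c \<in> carrier_vec k"
      then have Yc: "Y *\<^sub>v c \<in> Qspace" using surj by auto
      then have "?T *\<^sub>v (Y *\<^sub>v c) = c" using Tv[OF in_carrier(2)] L(2)[OF c] by (simp add: Qspace_def)
      then show "c \<in> (\<lambda>w. ?T *\<^sub>v w) ` W" using Yc by (auto simp: Qspace_def intro!: image_eqI[of c _ "Y *\<^sub>v c"])
    qed (use key in auto)
    show "{w \<in> W. ?T *\<^sub>v w = 0\<^sub>v k} = U"
    proof (intro equalityI subsetI)
      fix w assume "w \<in> {w \<in> W. ?T *\<^sub>v w = 0\<^sub>v k}"
      then have w: "w \<in> W" "Q *\<^sub>v w = Y *\<^sub>v 0\<^sub>v k" using key by auto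
      then show "w \<in> U" using Q_kernel mult_mat_zero_vec[OF Y] by simp
    next
      fix u assume u: "u \<in> U"
      then have "?T *\<^sub>v u = 0\<^sub>v k" using Tv[OF in_carrier(1)] Q_on_U mult_mat_zero_vec[OF L(1)] by simp
      then show "u \<in> {w \<in> W. ?T *\<^sub>v w = 0\<^sub>v k}" using u UW by auto
    qed
    fix s w assume w: "w \<in> W"
    have "Q *\<^sub>v (\<rho> s *\<^sub>v w) = \<sigma> s *\<^sub>v (Q *\<^sub>v w)"
      using sigma_on_W[OF Q_range[OF in_carrier(2)[OF w]]] Q_rho[OF w] by simp
    also have "\<dots> = (\<sigma> s * Y) *\<^sub>v (?T *\<^sub>v w)"
      using key[OF w] assoc_mult_mat_vec[OF sigma_carrier Y key(2)[OF w]] by simp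
    also have "\<dots> = Y *\<^sub>v (\<tau> s *\<^sub>v (?T *\<^sub>v w))"
      unfolding inter by (rule assoc_mult_mat_vec[OF Y tau key(2)[OF w]])
    finally have "L *\<^sub>v (Q *\<^sub>v (\<rho> s *\<^sub>v w)) = \<tau> s *\<^sub>v (?T *\<^sub>v w)"
      using L(2) mult_mat_vec_carrier[OF tau key(2)[OF w]] by simp
    then show "?T *\<^sub>v (\<rho> s *\<^sub>v w) = \<tau> s *\<^sub>v (?T *\<^sub>v w)"
      using Tv[OF mult_mat_vec_carrier[OF rho_carrier in_carrier(2)[OF w]]] by simp
  qed
qed

text \<open>
  On the image of \<open>Q\<close> the surjection \<open>T\<close> is injective, with an inverse \<open>L\<close>. Then
  \<open>\<sigma>(s) = L (T \<sigma>(s))\<close> and \<open>\<tau>(s) = T \<sigma>(s) L\<close> have the same trace.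
\<close>

lemma trace_of_equivalent_factor:
  assumes eq: "factor_equivalent UNIV N \<rho> U W k \<tau>" and tau: "\<And>s. \<tau> s \<in> carrier_mat k k"
  shows "mat_trace (\<sigma> s) = mat_trace (\<tau> s)"
proof -
  obtain T where T: "T \<in> carrier_mat k N" "(\<lambda>w. T *\<^sub>v w) ` W = carrier_vec k"
    "{w \<in> W. T *\<^sub>v w = 0\<^sub>v k} = U" "\<And>s w. w \<in> W \<Longrightarrow> T *\<^sub>v (\<rho> s *\<^sub>v w) = \<tau> s *\<^sub>v (T *\<^sub>v w)"
    using eq unfolding factor_equivalent_def by blast
  have TQ: "T *\<^sub>v (Q *\<^sub>v w) = T *\<^sub>v w" if w: "w \<in> W" for w
  proof -
    note c = in_carrier(2)[OF w]
    have "T *\<^sub>v w - T *\<^sub>v (Q *\<^sub>v w) = T *\<^sub>v (w - Q *\<^sub>v w)"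
      using mult_minus_distrib_mat_vec[OF T(1) c mult_mat_vec_carrier[OF Q_carrier c]] by simp
    also have "\<dots> = 0\<^sub>v k" using T(3) Q_mod_U[OF w] by auto
    finally have z: "T *\<^sub>v w - T *\<^sub>v (Q *\<^sub>v w) = 0\<^sub>v k" .
    have d: "T *\<^sub>v w \<in> carrier_vec k" "T *\<^sub>v (Q *\<^sub>v w) \<in> carrier_vec k"
      using mult_mat_vec_carrier[OF T(1)] c mult_mat_vec_carrier[OF Q_carrier c] by auto
    show ?thesis using vec_diff_cancel(1)[OF d] d unfolding z by simp
  qed
  have "w = 0\<^sub>v N" if "w \<in> Qspace" "T *\<^sub>v w = 0\<^sub>v k" for w
  proof -
    have "w \<in> U" using that T(3) by (auto simp: Qspace_def)
    then show ?thesis using that Q_on_U by (auto simp: Qspace_def)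
  qed
  from left_inverse_on_subspace[OF Qspace_subspace T(1) this] obtain L where L: "L \<in> carrier_mat N k"
    "\<And>y. y \<in> carrier_vec k \<Longrightarrow> L *\<^sub>v y \<in> Qspace" "\<And>w. w \<in> Qspace \<Longrightarrow> L *\<^sub>v (T *\<^sub>v w) = w" by metis
  have TL: "T *\<^sub>v (L *\<^sub>v y) = y" if y: "y \<in> carrier_vec k" for y
  proof -
    obtain w where w: "w \<in> W" "y = T *\<^sub>v w" using T(2) y by (metis imageE)
    have q: "Q *\<^sub>v w \<in> Qspace" using Q_idem[OF w(1)] Q_range[OF in_carrier(2)[OF w(1)]] by (simp add: Qspace_def)
    have "y = T *\<^sub>v (Q *\<^sub>v w)" using TQ w by simp
    then show ?thesis using L(3)[OF q] by simp
  qed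
  have Tsc: "T * \<sigma> s \<in> carrier_mat k N" by (rule mult_carrier_mat[OF T(1) sigma_carrier])
  have "\<sigma> s = L * (T * \<sigma> s)"
  proof (rule eq_mat_by_action)
    fix v :: "'k vec" assume v: "v \<in> carrier_vec N"
    have sv: "\<sigma> s *\<^sub>v v \<in> Qspace"
    proof -
      have c: "\<rho> s *\<^sub>v (Q *\<^sub>v v) \<in> carrier_vec N"
        by (intro mult_mat_vec_carrier[OF rho_carrier] mult_mat_vec_carrier[OF Q_carrier v])
      show ?thesis unfolding sigma_apply[OF v] Qspace_def using Q_idem'[OF c] Q_range[OF c] by simp
    qed
    have "(L * (T * \<sigma> s)) *\<^sub>v v = L *\<^sub>v ((T * \<sigma> s) *\<^sub>v v)" by (rule assoc_mult_mat_vec[OF L(1) Tsc v])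
    also have "\<dots> = L *\<^sub>v (T *\<^sub>v (\<sigma> s *\<^sub>v v))" using assoc_mult_mat_vec[OF T(1) sigma_carrier v] by simp
    also have "\<dots> = \<sigma> s *\<^sub>v v" by (rule L(3)[OF sv])
    finally show "\<sigma> s *\<^sub>v v = (L * (T * \<sigma> s)) *\<^sub>v v" by simp
  qed (use mult_carrier_mat[OF L(1) Tsc] in auto)
  then have "mat_trace (\<sigma> s) = mat_trace (L * (T * \<sigma> s))" by simp
  also have "\<dots> = mat_trace (T * \<sigma> s * L)" by (rule mat_trace_comm[OF L(1) Tsc])
  also have "T * \<sigma> s * L = \<tau> s"
  proof (rule eq_mat_by_action)
    fix y :: "'k vec" assume y: "y \<in> carrier_vec k"
    note q = L(2)[OF y]
    then have w: "L *\<^sub>v y \<in> W" by (simp add: Qspace_def)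
    note c = in_carrier(2)[OF w]
    have "(T * \<sigma> s * L) *\<^sub>v y = (T * \<sigma> s) *\<^sub>v (L *\<^sub>v y)" by (rule assoc_mult_mat_vec[OF Tsc L(1) y])
    also have "\<dots> = T *\<^sub>v (\<sigma> s *\<^sub>v (L *\<^sub>v y))" by (rule assoc_mult_mat_vec[OF T(1) sigma_carrier c])
    also have "\<dots> = T *\<^sub>v (\<rho> s *\<^sub>v (L *\<^sub>v y))" unfolding sigma_on_W[OF w] by (rule TQ[OF rho_invariant(2)[OF w]])
    also have "\<dots> = \<tau> s *\<^sub>v y" using T(4)[OF w] TL[OF y] by simp
    finally show "(T * \<sigma> s * L) *\<^sub>v y = \<tau> s *\<^sub>v y" .
  qed (use mult_carrier_mat[OF Tsc L(1)] tau in auto)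
  finally show ?thesis .
qed

end

section \<open>Composition series\<close>

definition subspace_projection :: "nat \<Rightarrow> 'k::field vec set \<Rightarrow> 'k mat" where
  "subspace_projection N W = (SOME P. P \<in> carrier_mat N N \<and> (\<forall>v\<in>carrier_vec N. P *\<^sub>v v \<in> W) \<and>
     (\<forall>w\<in>W. P *\<^sub>v w = w))"

lemma subspace_projection:
  assumes "vec_subspace N W"
  shows "subspace_projection N W \<in> carrier_mat N N"
    "\<And>v. v \<in> carrier_vec N \<Longrightarrow> subspace_projection N W *\<^sub>v v \<in> W"
    "\<And>w. w \<in> W \<Longrightarrow> subspace_projection N W *\<^sub>v w = w"
proof -
  have "\<exists>P. P \<in> carrier_mat N N \<and> (\<forall>v\<in>carrier_vec N. P *\<^sub>v v \<in> W) \<and> (\<forall>w\<in>W. P *\<^sub>v w = w)"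
    using projection_onto_subspace[OF assms] by metis
  from someI_ex[OF this, folded subspace_projection_def]
  show "subspace_projection N W \<in> carrier_mat N N"
    "\<And>v. v \<in> carrier_vec N \<Longrightarrow> subspace_projection N W *\<^sub>v v \<in> W"
    "\<And>w. w \<in> W \<Longrightarrow> subspace_projection N W *\<^sub>v w = w" by auto
qed

abbreviation factor_rep :: "nat \<Rightarrow> ('s::semigroup_mult \<Rightarrow> 'k::field mat) \<Rightarrow> 'k vec set \<Rightarrow> 'k vec set \<Rightarrow> 's \<Rightarrow> 'k mat" where
  "factor_rep N \<rho> U W \<equiv> subquotient.\<sigma> \<rho> (subspace_projection N U) (subspace_projection N W)"

lemma subquotient_projections:
  assumes "matrix_rep UNIV N \<rho>" "invariant_subspace UNIV N \<rho> U" "invariant_subspace UNIV N \<rho> W" "U \<subseteq> W"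
  shows "subquotient N \<rho> U W (subspace_projection N U) (subspace_projection N W)"
  using assms subspace_projection[of N U] subspace_projection[of N W]
  by unfold_locales (auto simp: invariant_subspace_iff)

lemma composition_series_step:
  assumes "composition_series UNIV N \<rho> Ws" "matrix_rep UNIV N \<rho>" "Suc i < length Ws"
  shows "subquotient N \<rho> (Ws ! i) (Ws ! Suc i)
      (subspace_projection N (Ws ! i)) (subspace_projection N (Ws ! Suc i))"
    and "\<And>V. invariant_subspace UNIV N \<rho> V \<Longrightarrow> Ws ! i \<subseteq> V \<Longrightarrow> V \<subseteq> Ws ! Suc i \<Longrightarrow>
      V = Ws ! i \<or> V = Ws ! Suc i"
proof -
  note cs = assms(1)[unfolded composition_series_def]
  have "Ws ! i \<in> set Ws" "Ws ! Suc i \<in> set Ws" using assms(3) by auto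
  moreover have "Ws ! i \<subseteq> Ws ! Suc i" using cs assms(3) by blast
  ultimately show "subquotient N \<rho> (Ws ! i) (Ws ! Suc i)
      (subspace_projection N (Ws ! i)) (subspace_projection N (Ws ! Suc i))"
    using cs by (intro subquotient_projections[OF assms(2)]) auto
  show "V = Ws ! i \<or> V = Ws ! Suc i"
    if "invariant_subspace UNIV N \<rho> V" "Ws ! i \<subseteq> V" "V \<subseteq> Ws ! Suc i" for V
    using cs assms(3) that by blast
qed

text \<open>
  The traces on consecutive members of the series telescope.
\<close>

lemma trace_composition_series:
  assumes cs: "composition_series UNIV N \<rho> Ws" and rep: "matrix_rep UNIV N \<rho>"
  shows "mat_trace (\<rho> s) = (\<Sum>i | Suc i < length Ws. mat_trace (factor_rep N \<rho> (Ws ! i) (Ws ! Suc i) s))"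
proof -
  note c = cs[unfolded composition_series_def]
  have rho: "\<rho> s \<in> carrier_mat N N" using rep by (auto simp: matrix_rep_def)
  let ?\<pi> = "\<lambda>i. subspace_projection N (Ws ! i)"
  have ne: "Ws \<noteq> []" using c by blast
  have inv: "vec_subspace N (Ws ! i)" if "i < length Ws" for i
    using c that by (auto simp: invariant_subspace_iff)
  have set: "{i. Suc i < length Ws} = {..<length Ws - 1}" by auto
  have "(\<Sum>i | Suc i < length Ws. mat_trace (factor_rep N \<rho> (Ws ! i) (Ws ! Suc i) s)) =
      (\<Sum>i<length Ws - 1. mat_trace (\<rho> s * ?\<pi> (Suc i)) - mat_trace (\<rho> s * ?\<pi> i))"
    unfolding set
    by (intro sum.cong refl subquotient.trace_sigma[OF composition_series_step(1)[OF cs rep]]) auto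
  also have "\<dots> = mat_trace (\<rho> s * ?\<pi> (length Ws - 1)) - mat_trace (\<rho> s * ?\<pi> 0)"
    by (rule sum_lessThan_telescope)
  also have "?\<pi> (length Ws - 1) = 1\<^sub>m N"
  proof (rule eq_mat_by_action)
    have l: "Ws ! (length Ws - 1) = carrier_vec N" using c ne by (simp add: last_conv_nth)
    have "vec_subspace N (Ws ! (length Ws - 1))" using inv ne by simp
    note P = subspace_projection[OF this]
    show "?\<pi> (length Ws - 1) \<in> carrier_mat N N" by (rule P)
    show "?\<pi> (length Ws - 1) *\<^sub>v v = 1\<^sub>m N *\<^sub>v v" if "v \<in> carrier_vec N" for v
      using P(3)[of v] l that by simp
  qed simp
  also have "?\<pi> 0 = 0\<^sub>m N N"
  proof (rule eq_mat_by_action)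
    have z: "Ws ! 0 = {0\<^sub>v N}" using c ne by (simp add: hd_conv_nth)
    have "vec_subspace N (Ws ! 0)" using inv ne by simp
    note P = subspace_projection[OF this]
    show "?\<pi> 0 \<in> carrier_mat N N" by (rule P)
    show "?\<pi> 0 *\<^sub>v v = 0\<^sub>m N N *\<^sub>v v" if "v \<in> carrier_vec N" for v
      using P(2)[OF that] z that by (auto intro!: eq_vecI)
  qed simp
  also have "mat_trace (\<rho> s * 1\<^sub>m N) - mat_trace (\<rho> s * 0\<^sub>m N N) = mat_trace (\<rho> s)"
    using rho by (simp add: right_mult_one_mat[OF rho] right_mult_zero_mat[OF rho] mat_trace_def)
  finally show ?thesis by simp
qed

text \<open>
  Below a nonzero invariant subspace, a proper invariant subspace of largest dimension leaves a
  simple factor; continue below it.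
\<close>

lemma composition_series_exists:
  assumes rep: "matrix_rep A N \<rho>"
  shows "\<exists>Ws. composition_series A N \<rho> Ws"
proof -
  let ?inv = "invariant_subspace A N \<rho>"
  let ?step = "\<lambda>U W. U \<subset> W \<and> (\<forall>V. ?inv V \<and> U \<subseteq> V \<and> V \<subseteq> W \<longrightarrow> V = U \<or> V = W)"
  have rho: "\<rho> s \<in> carrier_mat N N" if "s \<in> A" for s using rep that by (auto simp: matrix_rep_def)
  have inv0: "?inv {0\<^sub>v N}"
    by (auto simp: invariant_subspace_iff vec_subspace_def mult_mat_zero_vec[OF rho])
  have inv1: "?inv (carrier_vec N)"
    by (auto simp: invariant_subspace_iff vec_subspace_def mult_mat_vec_carrier[OF rho])
  have "\<exists>Ws. Ws \<noteq> [] \<and> hd Ws = {0\<^sub>v N} \<and> last Ws = W \<and> (\<forall>V\<in>set Ws. ?inv V) \<and>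
      (\<forall>i. Suc i < length Ws \<longrightarrow> ?step (Ws ! i) (Ws ! Suc i))" if "?inv W" for W
    using that
  proof (induction "subspace_dim W" arbitrary: W rule: less_induct)
    case less
    note W = less.prems
    show ?case
    proof (cases "W = {0\<^sub>v N}")
      case True
      show ?thesis by (rule exI[of _ "[W]"]) (use True inv0 in auto)
    next
      case False
      let ?P = "\<lambda>U. ?inv U \<and> U \<subset> W"
      have lt: "subspace_dim U < subspace_dim V" if "?inv U" "?inv V" "U \<subset> V" for U V
        using that subspace_dim_strict_mono by (auto simp: invariant_subspace_iff)
      have "?P {0\<^sub>v N}"
        using False inv0 W vec_subspaceD(2)[of N W] by (auto simp: invariant_subspace_iff)
      moreover have "\<forall>U. ?P U \<longrightarrow> subspace_dim U < subspace_dim W"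
        using lt W by blast
      ultimately have "\<exists>U. ?P U \<and> (\<forall>V. ?P V \<longrightarrow> subspace_dim V \<le> subspace_dim U)"
        by (rule ex_has_greatest_nat[where P = ?P and f = subspace_dim])
      then obtain U where U: "?P U" "\<And>V. ?P V \<Longrightarrow> subspace_dim V \<le> subspace_dim U" by metis
      have "?step U W"
      proof (intro conjI allI impI)
        fix V assume V: "?inv V \<and> U \<subseteq> V \<and> V \<subseteq> W"
        show "V = U \<or> V = W"
        proof (rule ccontr)
          assume "\<not> (V = U \<or> V = W)"
          then have "?P V" "U \<subset> V" using V by auto
          then show False using U(2)[of V] lt[of U V] U(1) by auto
        qed
      qed (use U in auto)
      from less.hyps[of U] U(1) lt W obtain Ws where Ws: "Ws \<noteq> []" "hd Ws = {0\<^sub>v N}" "last Ws = U"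
        "\<forall>V\<in>set Ws. ?inv V" "\<And>i. Suc i < length Ws \<Longrightarrow> ?step (Ws ! i) (Ws ! Suc i)"
        by blast
      have "?step ((Ws @ [W]) ! i) ((Ws @ [W]) ! Suc i)" if i: "Suc i < length (Ws @ [W])" for i
      proof (cases "Suc i < length Ws")
        case True
        have eq: "(Ws @ [W]) ! i = Ws ! i" "(Ws @ [W]) ! Suc i = Ws ! Suc i"
          using True by (auto simp: nth_append)
        show ?thesis unfolding eq by (rule Ws(5)[OF True])
      next
        case False
        then have i: "i = length Ws - 1" "Suc i = length Ws" using i Ws(1) by auto
        then have eq: "(Ws @ [W]) ! i = U" "(Ws @ [W]) ! Suc i = W"
          using Ws(1,3) by (simp_all add: nth_append last_conv_nth)
        show ?thesis unfolding eq by (rule \<open>?step U W\<close>)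
      qed
      then show ?thesis using Ws W by (intro exI[of _ "Ws @ [W]"]) auto
    qed
  qed
  from this[OF inv1] show ?thesis unfolding composition_series_def by blast
qed

section \<open>The pairing\<close>

context induced_representation
begin

abbreviation "pairing \<equiv> semigroup_pairing e (\<lambda>g. mat_trace (\<phi> g))"

lemma idempotents_below: "{f \<in> idempotents. f \<le> e} = {f. f \<le> e}"
  using le_idempotent(1)[OF e] by auto

lemma pairing_eq:
  "pairing \<theta> = 1 / of_nat (card G) *
     (\<Sum>g\<in>G. mat_trace (\<phi> (sinv g)) * (\<Sum>f | f \<le> e. of_int (mobius f e) * \<theta> (f * g)))"
proof -
  have "pairing \<theta> = (\<Sum>f | f \<le> e. 1 / of_nat (card G) *
      (\<Sum>g\<in>G. mat_trace (\<phi> (sinv g)) * (of_int (mobius f e) * \<theta> (f * g))))"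
    unfolding semigroup_pairing_def idempotents_below group_pairing_max_subgroup
    by (intro sum.cong refl) (simp add: sum_distrib_right sum_distrib_left algebra_simps)
  also have "\<dots> = 1 / of_nat (card G) * (\<Sum>f | f \<le> e.
      \<Sum>g\<in>G. mat_trace (\<phi> (sinv g)) * (of_int (mobius f e) * \<theta> (f * g)))"
    by (simp only: sum_distrib_left)
  also have "(\<Sum>f | f \<le> e. \<Sum>g\<in>G. mat_trace (\<phi> (sinv g)) * (of_int (mobius f e) * \<theta> (f * g))) =
      (\<Sum>g\<in>G. \<Sum>f | f \<le> e. mat_trace (\<phi> (sinv g)) * (of_int (mobius f e) * \<theta> (f * g)))"
    by (rule sum.swap)
  finally show ?thesis by (simp only: sum_distrib_left)
qed

lemma pairing_sum: "pairing (\<lambda>s. \<Sum>i\<in>I. F i s) = (\<Sum>i\<in>I. pairing (F i))"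
proof -
  have "(\<Sum>i\<in>I. pairing (F i)) = 1 / of_nat (card G) * (\<Sum>i\<in>I. \<Sum>g\<in>G. \<Sum>f | f \<le> e.
      mat_trace (\<phi> (sinv g)) * (of_int (mobius f e) * F i (f * g)))"
    by (simp only: pairing_eq sum_distrib_left)
  also have "(\<Sum>i\<in>I. \<Sum>g\<in>G. \<Sum>f | f \<le> e. mat_trace (\<phi> (sinv g)) * (of_int (mobius f e) * F i (f * g))) =
     (\<Sum>g\<in>G. \<Sum>i\<in>I. \<Sum>f | f \<le> e. mat_trace (\<phi> (sinv g)) * (of_int (mobius f e) * F i (f * g)))"
    by (rule sum.swap)
  also have "\<dots> = (\<Sum>g\<in>G. \<Sum>f | f \<le> e. \<Sum>i\<in>I. mat_trace (\<phi> (sinv g)) * (of_int (mobius f e) * F i (f * g)))"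
    by (intro sum.cong refl sum.swap)
  finally show ?thesis by (simp only: pairing_eq sum_distrib_left)
qed

section \<open>Evaluation on simple factors\<close>

text \<open>
  The image under \<open>\<sigma>\<close> of the alternating sum \<open>\<Sum>\<^sub>f \<mu>(f, e) f\<close> in the semigroup algebra.
\<close>

definition mobius_element :: "nat \<Rightarrow> ('s \<Rightarrow> 'k mat) \<Rightarrow> 'k mat" where
  "mobius_element N \<sigma> = mat_sum N N (\<lambda>f. of_int (mobius f e) \<cdot>\<^sub>m \<sigma> f) {f. f \<le> e}"

lemma mobius_element_carrier [simp]: "mobius_element N \<sigma> \<in> carrier_mat N N"
  by (simp add: mobius_element_def)

lemma mult_mobius_element:
  assumes rep: "matrix_rep UNIV N \<sigma>"
  shows "\<sigma> s * mobius_element N \<sigma> = mat_sum N N (\<lambda>h. of_int (mobius h e) \<cdot>\<^sub>m \<sigma> (s * h)) {h. h \<le> e}"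
proof -
  have c: "\<sigma> t \<in> carrier_mat N N" and m: "\<sigma> (t * u) = \<sigma> t * \<sigma> u" for t u
    using rep by (auto simp: matrix_rep_def)
  have "\<sigma> s * mobius_element N \<sigma> = mat_sum N N (\<lambda>h. \<sigma> s * (of_int (mobius h e) \<cdot>\<^sub>m \<sigma> h)) {h. h \<le> e}"
    unfolding mobius_element_def by (rule mult_mat_sum[OF c]) (use c in auto)
  then show ?thesis by (simp add: mult_smult_distrib[OF c c] m)
qed

text \<open>
  The coefficient of \<open>t\<close> in the product of \<open>f\<close> with the Moebius sum is the sum of \<open>mobius h e\<close>
  over all \<open>h \<le> e\<close> with \<open>f h = t\<close>, which vanishes by Weisner's theorem.
\<close>

lemma below_annihilates_mobius_element:
  assumes rep: "matrix_rep UNIV N \<sigma>" and f: "f < e"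
  shows "\<sigma> f * mobius_element N \<sigma> = 0\<^sub>m N N"
  unfolding mult_mobius_element[OF rep]
proof (rule eq_matI)
  have c: "\<sigma> t \<in> carrier_mat N N" for t using rep by (auto simp: matrix_rep_def)
  fix i j assume "i < dim_row (0\<^sub>m N N :: 'k mat)" "j < dim_col (0\<^sub>m N N :: 'k mat)"
  then have ij: "i < N" "j < N" by auto
  have "mat_sum N N (\<lambda>h. of_int (mobius h e) \<cdot>\<^sub>m \<sigma> (f * h)) {h. h \<le> e} $$ (i, j) =
      (\<Sum>h | h \<le> e. of_int (mobius h e) * \<sigma> (f * h) $$ (i, j))"
    using ij carrier_matD[OF c] by simp
  also have "\<dots> = (\<Sum>t\<in>UNIV. \<Sum>h | h \<in> {h. h \<le> e} \<and> f * h = t. of_int (mobius h e) * \<sigma> (f * h) $$ (i, j))"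
    by (rule sum.group[symmetric]) auto
  also have "\<dots> = (\<Sum>t\<in>UNIV. of_int (\<Sum>h | h \<le> e \<and> f * h = t. mobius h e) * \<sigma> t $$ (i, j))"
    by (intro sum.cong refl) (simp add: sum_distrib_right)
  also have "\<dots> = 0" by (simp only: weisner_mobius_sum[OF e f]) simp
  finally show "mat_sum N N (\<lambda>h. of_int (mobius h e) \<cdot>\<^sub>m \<sigma> (f * h)) {h. h \<le> e} $$ (i, j) = 0\<^sub>m N N $$ (i, j)"
    using ij by simp
qed auto

text \<open>
  The pairing is the trace of an operator on matrices whose values are homomorphisms from \<open>\<phi>\<close> to
  \<open>\<sigma>\<close>; if it is nonzero, such a homomorphism exists.
\<close>

lemma pairing_trace:
  assumes rep: "matrix_rep UNIV N \<sigma>"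
  shows "pairing (\<lambda>s. mat_trace (\<sigma> s)) =
    (\<Sum>i<N. \<Sum>j<n. group_average N \<sigma> (mobius_element N \<sigma> * unit_mat N n i j) $$ (i, j))"
proof -
  have c: "\<sigma> t \<in> carrier_mat N N" and m: "\<sigma> (t * u) = \<sigma> t * \<sigma> u" for t u
    using rep by (auto simp: matrix_rep_def)
  have repG: "matrix_rep G N \<sigma>" using rep by (auto simp: matrix_rep_def)
  have "mat_trace (\<sigma> g * mobius_element N \<sigma>) = (\<Sum>f | f \<le> e. of_int (mobius f e) * mat_trace (\<sigma> (f * g)))" for g
  proof -
    have "mat_trace (\<sigma> g * mobius_element N \<sigma>) =
        (\<Sum>i<N. \<Sum>h | h \<le> e. of_int (mobius h e) * \<sigma> (g * h) $$ (i, i))"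
      unfolding mult_mobius_element[OF rep] using carrier_matD[OF c] by (simp add: mat_trace_def)
    also have "\<dots> = (\<Sum>h | h \<le> e. \<Sum>i<N. of_int (mobius h e) * \<sigma> (g * h) $$ (i, i))" by (rule sum.swap)
    also have "\<dots> = (\<Sum>h | h \<le> e. of_int (mobius h e) * mat_trace (\<sigma> (g * h)))"
      using carrier_matD[OF c] by (simp add: mat_trace_def sum_distrib_left)
    also have "\<dots> = (\<Sum>h | h \<le> e. of_int (mobius h e) * mat_trace (\<sigma> (h * g)))"
      using mat_trace_comm[OF c c] by (simp add: m)
    finally show ?thesis .
  qed
  then show ?thesis
    by (simp add: trace_group_average[OF repG mobius_element_carrier] pairing_eq)
qed

lemma pairing_star: "pairing (\<lambda>s. mat_trace (star s)) = of_nat (endomorphism_dim G n \<phi>)"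
proof -
  have "(\<Sum>f | f \<le> e. of_int (mobius f e) * mat_trace (star (f * g))) = mat_trace (\<phi> g)" if g: "g \<in> G" for g
  proof -
    have "(\<Sum>f | f \<le> e. of_int (mobius f e) * mat_trace (star (f * g))) =
        (\<Sum>f | f \<le> e. if f = e then mat_trace (\<phi> g) else 0)"
      by (intro sum.cong refl) (use g in \<open>auto simp: trace_star mobius.simps[of e e]\<close>)
    then show ?thesis by simp
  qed
  then show ?thesis using norm_character by (simp add: pairing_eq cong: sum.cong)
qed

text \<open>
  Irreducibility is used twice. If the pairing is nonzero, a nonzero homomorphism from \<open>\<phi>\<close> is at
  hand; it extends to an injective homomorphism from \<open>\<phi>\<^sup>*\<close>, whose image is all of the simple
  factor.
\<close>

lemma pairing_simple_factor:
  assumes sq: "subquotient N \<rho> U W pU pW"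
    and simple: "\<And>V. invariant_subspace UNIV N \<rho> V \<Longrightarrow> U \<subseteq> V \<Longrightarrow> V \<subseteq> W \<Longrightarrow> V = U \<or> V = W"
  shows "pairing (\<lambda>s. mat_trace (subquotient.\<sigma> \<rho> pU pW s)) =
    (if factor_equivalent UNIV N \<rho> U W k star then of_nat (endomorphism_dim G n \<phi>) else 0)"
proof -
  interpret subquotient N \<rho> U W pU pW by fact
  show ?thesis
  proof (cases "factor_equivalent UNIV N \<rho> U W k star")
    case True
    then show ?thesis using trace_of_equivalent_factor[OF True star_carrier] pairing_star by simp
  next
    case False
    have "pairing (\<lambda>s. mat_trace (\<sigma> s)) = 0"
    proof (rule ccontr)
      assume "pairing (\<lambda>s. mat_trace (\<sigma> s)) \<noteq> 0"
      then obtain i j where ij: "i < N" "j < n"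
        "group_average N \<sigma> (mobius_element N \<sigma> * unit_mat N n i j) $$ (i, j) \<noteq> 0"
        unfolding pairing_trace[OF rep_sigma] by (metis (no_types, lifting) lessThan_iff sum.neutral)
      let ?Y0 = "mobius_element N \<sigma> * unit_mat N n i j"
      let ?X = "group_average N \<sigma> ?Y0"
      have Y0: "?Y0 \<in> carrier_mat N n" by (rule mult_carrier_mat[OF mobius_element_carrier unit_mat_carrier])
      have nz: "?X \<noteq> 0\<^sub>m N n" using ij by auto
      have repG: "matrix_rep G N \<sigma>" using rep_sigma by (auto simp: matrix_rep_def)
      have sm: "\<sigma> (s * t) = \<sigma> s * \<sigma> t" for s t using rep_sigma by (auto simp: matrix_rep_def)
      have ann: "\<sigma> f * ?Y0 = 0\<^sub>m N n" if f: "f < e" for f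
      proof -
        have "\<sigma> f * ?Y0 = \<sigma> f * mobius_element N \<sigma> * unit_mat N n i j"
          by (rule assoc_mult_mat[OF sigma_carrier mobius_element_carrier unit_mat_carrier, symmetric])
        then show ?thesis
          using below_annihilates_mobius_element[OF rep_sigma f] left_mult_zero_mat[OF unit_mat_carrier] by simp
      qed
      \<comment> \<open>The average is annihilated by \<open>f < e\<close>: moving \<open>f\<close> past \<open>g\<close> conjugates it into another
      idempotent strictly below \<open>e\<close>, which annihilates the Moebius sum.\<close>
      interpret subgroup_hom e n \<phi> fs p N \<sigma> ?X
      proof (unfold_locales)
        show "\<sigma> f * ?X = 0\<^sub>m N n" if f: "f < e" for f
        proof -
          have "\<sigma> f * (\<sigma> g * ?Y0 * \<phi> (sinv g)) = 0\<^sub>m N n" if g: "g \<in> G" for g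
          proof -
            let ?h = "sinv g * f * g"
            have fi: "f \<in> idempotents" using le_idempotent(1)[OF e] f by simp
            have sY: "\<sigma> g * ?Y0 \<in> carrier_mat N n" by (rule mult_carrier_mat[OF sigma_carrier Y0])
            have "\<sigma> f * (\<sigma> g * ?Y0 * \<phi> (sinv g)) = \<sigma> f * (\<sigma> g * ?Y0) * \<phi> (sinv g)"
              by (rule assoc_mult_mat[OF sigma_carrier sY phi_carrier[OF sinv_G[OF g]], symmetric])
            also have "\<sigma> f * (\<sigma> g * ?Y0) = \<sigma> (f * g) * ?Y0"
              unfolding sm by (rule assoc_mult_mat[OF sigma_carrier sigma_carrier Y0, symmetric])
            also have "\<dots> = \<sigma> g * (\<sigma> ?h * ?Y0)"
              unfolding idempotent_slide[OF fi] sm[of g]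
              by (rule assoc_mult_mat[OF sigma_carrier sigma_carrier Y0])
            also have "\<dots> = 0\<^sub>m N n"
              unfolding ann[OF conjugate_less[OF g f]] by (rule right_mult_zero_mat[OF sigma_carrier])
            also have "0\<^sub>m N n * \<phi> (sinv g) = 0\<^sub>m N n"
              by (rule left_mult_zero_mat[OF phi_carrier[OF sinv_G[OF g]]])
            finally show ?thesis .
          qed
          then have "\<sigma> f * mat_sum N n (\<lambda>g. \<sigma> g * ?Y0 * \<phi> (sinv g)) G = mat_sum N n (\<lambda>g. 0\<^sub>m N n) G"
            by (subst mult_mat_sum[OF sigma_carrier])
              (auto intro: sandwich_carrier[OF sigma_carrier Y0] mat_sum_cong)
          also have "\<dots> = 0\<^sub>m N n" by (rule eq_matI) auto
          finally show ?thesis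
            unfolding group_average_def by (simp add: mult_smult_distrib[OF sigma_carrier mat_sum_carrier])
        qed
      qed (use rep_sigma group_average_intertwines[OF repG Y0] in auto)
      let ?Z = "(\<lambda>v. Y *\<^sub>v v) ` carrier_vec k"
      have YQ: "Q *\<^sub>v (Y *\<^sub>v v) = Y *\<^sub>v v" if "v \<in> carrier_vec k" for v
        using assoc_mult_mat_vec[OF Q_carrier induced_map_carrier that, of \<sigma> ?X]
          mult_Y_fixed[OF Q_carrier Q_sigma] by simp
      have ZQ: "?Z \<subseteq> Qspace"
      proof (clarsimp simp: Qspace_def YQ)
        fix v :: "'k vec" assume v: "v \<in> carrier_vec k"
        show "Y *\<^sub>v v \<in> W"
          using Q_range[OF mult_mat_vec_carrier[OF induced_map_carrier v]] YQ[OF v] by metis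
      qed
      have sY: "\<sigma> s *\<^sub>v (Y *\<^sub>v v) = Y *\<^sub>v (star s *\<^sub>v v)" if "v \<in> carrier_vec k" for s v
        using assoc_mult_mat_vec[OF subquotient.sigma_carrier[OF sq] induced_map_carrier that, of s \<sigma> ?X]
          assoc_mult_mat_vec[OF induced_map_carrier star_carrier that, of N \<sigma> ?X s] Y_intertwines[of s] by simp
      have Zinv: "\<sigma> s *\<^sub>v z \<in> ?Z" if "z \<in> ?Z" for s z
        using that sY mult_mat_vec_carrier[OF star_carrier] by auto
      have "k > 0" using n_pos e_in_fs by (cases fs) auto
      then have u: "unit_vec k 0 \<in> carrier_vec k" "unit_vec k 0 \<noteq> (0\<^sub>v k :: 'k vec)"
        by auto
      then have "Y *\<^sub>v unit_vec k 0 \<noteq> 0\<^sub>v N" using Y_injective[OF nz u(1)] by blast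
      then have Znz: "?Z \<noteq> {0\<^sub>v N}" using u(1) by blast
      have onto: "Q *\<^sub>v w \<in> ?Z" if w: "w \<in> W" for w
      proof (rule simple_sigma)
        show "V = U \<or> V = W" if "invariant_subspace UNIV N \<rho> V" "U \<subseteq> V" "V \<subseteq> W" for V
          using that by (rule simple)
        show "\<sigma> s *\<^sub>v z \<in> ?Z" if "z \<in> ?Z" for s z using that by (rule Zinv)
      qed (fact vec_subspace_image[OF induced_map_carrier] ZQ Znz w)+
      have "Qspace \<subseteq> ?Z"
      proof
        fix x assume "x \<in> Qspace"
        then have "x \<in> W" "Q *\<^sub>v x = x" by (simp_all add: Qspace_def)
        then show "x \<in> ?Z" using onto[of x] by (simp only:)
      qed
      then have "?Z = Qspace" using ZQ by auto
      from factor_equivalentI[OF induced_map_carrier Y_intertwines star_carrier Y_injective[OF nz] this]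
      show False using False by simp
    qed
    then show ?thesis using False by simp
  qed
qed

lemma pairing_composition_series:
  assumes cs: "composition_series UNIV N \<rho> Ws" and aff: "affords UNIV N \<rho> \<theta>"
  shows "pairing \<theta> = of_nat (card {i. Suc i < length Ws \<and>
      factor_equivalent UNIV N \<rho> (Ws ! i) (Ws ! Suc i) k star} * endomorphism_dim G n \<phi>)"
proof -
  let ?d = "endomorphism_dim G n \<phi>" and ?I = "{i. Suc i < length Ws}"
  let ?E = "\<lambda>i. factor_equivalent UNIV N \<rho> (Ws ! i) (Ws ! Suc i) k star"
  have rep: "matrix_rep UNIV N \<rho>" and \<theta>: "\<theta> = (\<lambda>s. mat_trace (\<rho> s))"
    using aff by (auto simp: affords_def)
  have fin: "finite ?I" by (rule finite_subset[of _ "{..<length Ws}"]) auto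
  have "pairing \<theta> = (\<Sum>i\<in>?I. pairing (\<lambda>s. mat_trace (factor_rep N \<rho> (Ws ! i) (Ws ! Suc i) s)))"
    unfolding \<theta> trace_composition_series[OF cs rep] by (rule pairing_sum)
  also have "\<dots> = (\<Sum>i\<in>?I. if ?E i then of_nat ?d else 0)"
    by (intro sum.cong refl pairing_simple_factor)
      (use composition_series_step[OF cs rep] in auto)
  also have "\<dots> = (\<Sum>i\<in>{i \<in> ?I. ?E i}. of_nat ?d)"
    by (rule sum.inter_filter[symmetric, OF fin])
  also have "{i \<in> ?I. ?E i} = {i. Suc i < length Ws \<and> ?E i}" by auto
  finally show ?thesis by simp
qed

text \<open>
  All composition series give the same count, because the count times a positive number is the
  pairing, which is independent of the series. So the definite description of the
  multiplicity is met by any of them.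
\<close>

theorem pairing_eq_multiplicity:
  assumes aff: "affords UNIV N \<rho> \<theta>"
  shows "pairing \<theta> = of_nat (multiplicity_in UNIV k star N \<rho> * endomorphism_dim G n \<phi>)"
proof -
  let ?count = "\<lambda>Ws. card {i. Suc i < length Ws \<and> factor_equivalent UNIV N \<rho> (Ws ! i) (Ws ! Suc i) k star}"
  have rep: "matrix_rep UNIV N \<rho>" using aff by (simp add: affords_def)
  obtain Ws where Ws: "composition_series UNIV N \<rho> Ws" using composition_series_exists[OF rep] by blast
  have uniq: "?count Vs = ?count Ws" if "composition_series UNIV N \<rho> Vs" for Vs
  proof -
    have "(of_nat (?count Vs * endomorphism_dim G n \<phi>) :: 'k) = of_nat (?count Ws * endomorphism_dim G n \<phi>)"
      using pairing_composition_series[OF that aff] pairing_composition_series[OF Ws aff] by (simp only:)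
    then have "?count Vs * endomorphism_dim G n \<phi> = ?count Ws * endomorphism_dim G n \<phi>"
      by (simp only: of_nat_eq_iff)
    then show ?thesis using endomorphism_dim_pos by simp
  qed
  have "multiplicity_in UNIV k star N \<rho> = ?count Ws"
    unfolding multiplicity_in_def
  proof (rule the_equality)
    show "\<exists>Vs. composition_series UNIV N \<rho> Vs \<and> ?count Ws = ?count Vs"
      by (intro exI[of _ Ws] conjI Ws refl)
    fix m assume "\<exists>Vs. composition_series UNIV N \<rho> Vs \<and> m = ?count Vs"
    then obtain Vs where Vs: "composition_series UNIV N \<rho> Vs" "m = ?count Vs" by (elim exE conjE)
    show "m = ?count Ws" unfolding Vs(2) by (rule uniq[OF Vs(1)])
  qed
  then show ?thesis using pairing_composition_series[OF Ws aff] by simp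
qed

end

theorem theorem5p1:
  fixes e :: "'s::{finite,inverse_semigroup}"
    and \<theta> \<chi> :: "'s \<Rightarrow> 'k::field_char_0"
    and \<rho> \<phi> :: "'s \<Rightarrow> 'k mat"
    and N n m d :: nat
    and fs :: "'s list"
    and p :: "'s \<Rightarrow> 's"
  assumes "e \<in> idempotents"
    and "affords UNIV N \<rho> \<theta>"
    and "irreducible_rep (carrier (max_subgroup e)) n \<phi>"
    and "affords (carrier (max_subgroup e)) n \<phi> \<chi>"
    and "distinct fs" and "set fs = isomorphic_idempotents e"
    and "\<And>f. f \<in> isomorphic_idempotents e \<Longrightarrow> sdom (p f) = e \<and> sran (p f) = f"
    and "d = endomorphism_dim (carrier (max_subgroup e)) n \<phi>"
    and "m = multiplicity_in UNIV (length fs * n) (induced_rep n \<phi> fs p) N \<rho>"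
  shows "semigroup_pairing e \<chi> \<theta> =
           (\<Sum>f\<in>{f \<in> idempotents. f \<le> e}.
              group_pairing (max_subgroup e) \<chi> (\<lambda>s. \<theta> (f * s)) * of_int (mobius f e)) \<and>
         (\<Sum>f\<in>{f \<in> idempotents. f \<le> e}.
              group_pairing (max_subgroup e) \<chi> (\<lambda>s. \<theta> (f * s)) * of_int (mobius f e)) =
           of_nat (m * d)"
proof -
  interpret induced_representation e n \<phi> fs p
    by unfold_locales (use assms in auto)
  have "group_pairing (max_subgroup e) \<chi> \<alpha> = group_pairing (max_subgroup e) (\<lambda>g. mat_trace (\<phi> g)) \<alpha>" for \<alpha>
    unfolding group_pairing_max_subgroup using assms(4) by (simp add: affords_def cong: sum.cong)
  then have "semigroup_pairing e \<chi> \<theta> = pairing \<theta>"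
    unfolding semigroup_pairing_def by simp
  also have "\<dots> = of_nat (m * d)"
    using pairing_eq_multiplicity[OF assms(2)] assms(8,9) by simp
  finally show ?thesis unfolding semigroup_pairing_def by simp
qed

end
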